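(* Let (A1)–(A4) of the context hold and suppose that $f(x)-q(x,0)\le 0$ for a.e. $x\in S$. Consider a family of simplicial triangulations $\mathcal T_h$ ($h>0$) as in the context satisfying, with a constant $\sigma_0>0$ independent of $i,j$ and $h$, $$\nabla_{S_h}\chi_i\cdot\nabla_{S_h}\chi_j\le-\frac{\sigma_0}{h^2}<0\quad\text{on }\operatorname{supp}\chi_i\cap\operatorname{supp}\chi_j\subset S_h$$ for all $i=1,\dots,n$, $j=1,\dots,\bar n$, $i\ne j$, and suppose there are constants $m_1,m_2>0$ such that $m_1h^d\le\operatorname{meas}(T)\le m_2h^d$ for every $h>0$ and every simplex $T\in\mathcal T_h$, where $\operatorname{meas}$ denotes $d$-dimensional measure. Then for all sufficiently small $h$, every solution $u_h\in V_h$ of the discrete problem in the context satisfies $$\max_{\overline S}u_h^l\le\max\{0,\max_{\partial S}g_h^l\}.$$ In particular, if $g\ge0$ then $\max_{\overline S}u_h^l=\max_{\partial S}g_h^l$, and if $g\le0$ then $\max_{\overline S}u_h^l\le0$.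
   Context: Continuous data. $\mathcal M$ is a smooth complete $d$-dimensional Riemannian manifold, $S\subset\mathcal M$ a closed bounded regular subdomain, a smooth manifold with nonempty boundary $\partial S$. $S$ is embedded as a hypersurface in $\mathbb R^{d+1}$ with unit normal $\nu$, with an associated signed distance function $\delta$ such that $S=\{\delta=0\}$ and $\nabla\delta=\nu$ (on the set of points $P+s\nu(P)$, $P\in S$, $|s|$ small, where $\delta(P+s\nu(P))=s$). $p'=p/(p-1)$. The underlying boundary value problem is $-\operatorname{div}_S(b(x,u,\nabla_Su)\nabla_Su)+q(x,u)=f$ on $S$, $u=g$ on $\partial S$, with: (A1) $p\ge2$ is a given parameter. (A2) $b:S\times\mathbb R\times\mathbb R^{d+1}\to\mathbb R$, $q:\overline S\times\mathbb R\to\mathbb R$ are continuous; $f\in L^{p'}(S)$; $g=g^*|_{\partial S}$ for some $g^*\in W^{1,\gamma}(S)$, where $\gamma\ge p$ if $p>d$ and $\gamma>d$ if $p\le d$. (A3) There are constants $\mu_0,\mu_1,M_0,M_1>0$ with $\mu_0+\mu_1|\xi|^{p-2}\le b(x,z,\xi)\le M_0+M_1|\xi|^{p-2}$ for all $(x,z,\xi)\in S\times\mathbb R\times\mathbb R^{d+1}$. (A4) $2\le p_1<+\infty$ if $d\le p$, or $2\le p_1<\frac{2d}{d-p}$ if $d>p$; there are $\alpha,\beta\ge0$ such that for every $x\in S$: $0\le q(x,0)=q(x,z)$ for all $z\le0$, and $0\le q(x,z)-q(x,0)\le\alpha z+\beta z^{p_1-1}$ for all $z\ge0$. Discretization. $S$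 is approximated by a polyhedral surface $S_h=\bigcup_{T\in\mathcal T_h}T\subset\mathbb R^{d+1}$, where $\mathcal T_h$ is an admissible triangulation by $d$-simplices: $h$ is the maximal diameter, every $T$ has inradius at least $ch$ with $c>0$ independent of $h$, and $S_h$ is not a global double covering of $S$. The vertices $B_1,\dots,B_{\bar n}$ lie on $S$; $B_1,\dots,B_n$ (with $n<\bar n$) are those not on $\partial S_h$, and $B_{n+1},\dots,B_{\bar n}$ are those on $\partial S_h$, which lie on $\partial S$. $\nabla_{S_h}\phi=\nabla\phi-(\nabla\phi\cdot\nu_h)\nu_h$ (elementwise, $\nu_h$ the normal to $S_h$). $\chi_j$ is the continuous piecewise linear function on $S_h$ with $\chi_j(B_i)=\delta_{ij}$; $V_h=\operatorname{span}\{\chi_1,\dots,\chi_{\bar n}\}$, $V_h^0=\operatorname{span}\{\chi_1,\dots,\chi_n\}$. $g_h=\sum_{j=n+1}^{\bar n}g_j\chi_j$ with $g_j=g(B_j)$. Lift. Each $x\in S_h$ determines a unique $P=P(x)\in S$ by $x=P+\nu(P)\delta(x)$; $h$ is small enough that this is well defined, and $x\mapsto P(x)$ is regarded as a bijection of $S_h$ onto $S$ mapping $\partial S_h$ onto $\partial S$. The lift of $\eta_h:S_h\to\mathbb R$ is $\eta_h^l(P(x))=\eta_h(x)$. For the data, $b^{-l}(x,\cdot,\cdot)=b(P(x),\cdot,\cdot)$, $q^{-l}(x,\cdot)=q(P(x),\cdot)$, $f^{-l}(x)=f(P(x))$. Discrete problem: find $u_h\in V_h$ with $u_h-g_h\in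 V_h^0$ and $$\int_{S_h}\bigl(b^{-l}(x,u_h,\nabla_{S_h}u_h)\nabla_{S_h}u_h\cdot\nabla_{S_h}v_h+\hat q^{-l}(x,u_h)v_h\bigr)=\int_{S_h}\hat f^{-l}v_h\quad\forall v_h\in V_h^0,$$ where $\hat q^{-l}(x,z)=q^{-l}(x,z)-q^{-l}(x,0)$ and $\hat f^{-l}(x)=f^{-l}(x)-q^{-l}(x,0)$. *)

theory Defs
  imports "HOL-Analysis.Analysis"
begin

section \<open>Smooth hypersurfaces with boundary\<close>

text \<open>\<open>Ck_on k f U\<close> is meant for open \<open>U\<close>.\<close>

primrec Ck_on :: "nat \<Rightarrow> ('a::euclidean_space \<Rightarrow> 'b::real_normed_vector) \<Rightarrow> 'a set \<Rightarrow> bool" where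
  "Ck_on 0 f U \<longleftrightarrow> continuous_on U f"
| "Ck_on (Suc k) f U \<longleftrightarrow>
     (\<forall>x\<in>U. f differentiable (at x)) \<and> (\<forall>v. Ck_on k (\<lambda>x. frechet_derivative f (at x) v) U)"

definition smooth_on :: "'a::euclidean_space set \<Rightarrow> ('a \<Rightarrow> 'b::real_normed_vector) \<Rightarrow> bool" where
  "smooth_on U f \<longleftrightarrow> (\<forall>k. Ck_on k f U)"

definition smooth_chart :: "'a::euclidean_space set \<Rightarrow> ('a \<Rightarrow> 'a) \<Rightarrow> bool" where
  "smooth_chart W \<phi> \<longleftrightarrow>
     open W \<and> open (\<phi> ` W) \<and> smooth_on W \<phi> \<and>
     (\<exists>\<psi>. smooth_on (\<phi> ` W) \<psi> \<and> (\<forall>x\<in>W. \<psi> (\<phi> x) = x))"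

text \<open>Slice charts of the ambient space: near an interior point the set is straightened to a
  hyperplane, near a boundary point to a half-hyperplane with the point on its edge.\<close>

definition interior_slice_point :: "'a::euclidean_space set \<Rightarrow> 'a \<Rightarrow> bool" where
  "interior_slice_point S x \<longleftrightarrow>
     (\<exists>W \<phi>. \<exists>e\<in>Basis. smooth_chart W \<phi> \<and> x \<in> W \<and>
        \<phi> ` (S \<inter> W) = \<phi> ` W \<inter> {y. y \<bullet> e = 0})"

definition boundary_slice_point :: "'a::euclidean_space set \<Rightarrow> 'a \<Rightarrow> bool" where
  "boundary_slice_point S x \<longleftrightarrow>
     (\<exists>W \<phi>. \<exists>e\<in>Basis. \<exists>e'\<in>Basis - {e}. smooth_chart W \<phi> \<and> x \<in> W \<and>
        \<phi> ` (S \<inter> W) = \<phi> ` W \<inter> {y. y \<bullet> e = 0 \<and> 0 \<le> y \<bullet> e'} \<and> \<phi> x \<bullet> e' = 0)"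

definition mfd_boundary :: "'a::euclidean_space set \<Rightarrow> 'a set" where
  "mfd_boundary S = {x \<in> S. boundary_slice_point S x}"

definition smooth_hypersurface :: "'a::euclidean_space set \<Rightarrow> bool" where
  "smooth_hypersurface S \<longleftrightarrow> (\<forall>x\<in>S. interior_slice_point S x \<or> boundary_slice_point S x)"

text \<open>A compact regular subdomain of a connected manifold, with nonempty boundary, has no
  component without boundary; this is the content of the last conjunct. In particular it holds
  for connected \<open>S\<close> with nonempty boundary.\<close>

definition regular_subdomain :: "'a::euclidean_space set \<Rightarrow> bool" where
  "regular_subdomain S \<longleftrightarrow>
     closed S \<and> bounded S \<and> smooth_hypersurface S \<and> mfd_boundary S \<noteq> {} \<and>
     (\<forall>C\<in>components S. C \<inter> mfd_boundary S \<noteq> {})"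

text \<open>The curves are one-sided, so that the span is needed at boundary points, where it is the
  full tangent hyperplane.\<close>

definition tangent_space :: "'a::euclidean_space set \<Rightarrow> 'a \<Rightarrow> 'a set" where
  "tangent_space S x =
     span {v. \<exists>c :: real \<Rightarrow> 'a. c 0 = x \<and> (\<forall>t\<in>{0..1}. c t \<in> S) \<and>
                (c has_vector_derivative v) (at 0 within {0..1})}"

definition unit_normal :: "'a::euclidean_space set \<Rightarrow> ('a \<Rightarrow> 'a) \<Rightarrow> bool" where
  "unit_normal S \<nu> \<longleftrightarrow>
     (\<exists>U N. open U \<and> S \<subseteq> U \<and> smooth_on U N \<and> (\<forall>x\<in>S. \<nu> x = N x)) \<and>
     (\<forall>x\<in>S. norm (\<nu> x) = 1 \<and> (\<forall>v\<in>tangent_space S x. \<nu> x \<bullet> v = 0))"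

definition tube :: "'a::euclidean_space set \<Rightarrow> ('a \<Rightarrow> 'a) \<Rightarrow> real \<Rightarrow> 'a set" where
  "tube S \<nu> \<epsilon> = {P + s *\<^sub>R \<nu> P |P s. P \<in> S \<and> \<bar>s\<bar> \<le> \<epsilon>}"

text \<open>The tube is not a neighbourhood of the points over \<open>mfd_boundary S\<close>, hence the derivative
  relative to the tube. The injectivity says that \<open>\<epsilon>\<close> is small enough for the
  representation \<open>x = P + s \<nu>(P)\<close> to be unique.\<close>

definition signed_distance ::
  "'a::euclidean_space set \<Rightarrow> ('a \<Rightarrow> 'a) \<Rightarrow> real \<Rightarrow> ('a \<Rightarrow> real) \<Rightarrow> bool" where
  "signed_distance S \<nu> \<epsilon> \<delta> \<longleftrightarrow>
     0 < \<epsilon> \<and>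
     inj_on (\<lambda>(P, s). P + s *\<^sub>R \<nu> P) (S \<times> {-\<epsilon>..\<epsilon>}) \<and>
     {x \<in> tube S \<nu> \<epsilon>. \<delta> x = 0} = S \<and>
     (\<forall>P\<in>S. \<forall>s. \<bar>s\<bar> \<le> \<epsilon> \<longrightarrow>
        \<delta> (P + s *\<^sub>R \<nu> P) = s \<and>
        (\<delta> has_derivative (\<lambda>v. \<nu> P \<bullet> v)) (at (P + s *\<^sub>R \<nu> P) within tube S \<nu> \<epsilon>))"

definition nproj :: "'a::euclidean_space set \<Rightarrow> ('a \<Rightarrow> 'a) \<Rightarrow> ('a \<Rightarrow> real) \<Rightarrow> 'a \<Rightarrow> 'a" where
  "nproj S \<nu> \<delta> x = (THE P. P \<in> S \<and> x = P + \<delta> x *\<^sub>R \<nu> P)"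


section \<open>Surface measure and function spaces\<close>

text \<open>\<open>d\<close>-dimensional Hausdorff measure (for \<open>d \<ge> 1\<close>), normalised so as to agree with Lebesgue measure
  on \<open>d\<close>-dimensional planes, on the Caratheodory-measurable sets.\<close>

definition hausdorff_pre :: "nat \<Rightarrow> real \<Rightarrow> 'a::metric_space set \<Rightarrow> ennreal" where
  "hausdorff_pre d r A =
     (INF C \<in> {C :: nat \<Rightarrow> 'a set. A \<subseteq> (\<Union>i. C i) \<and> (\<forall>i. bounded (C i) \<and> diameter (C i) \<le> r)}.
        \<Sum>i. ennreal (unit_ball_vol (real d) * (diameter (C i) / 2) ^ d))"

definition hausdorff_outer :: "nat \<Rightarrow> 'a::metric_space set \<Rightarrow> ennreal" where
  "hausdorff_outer d A = (SUP r\<in>{0<..}. hausdorff_pre d r A)"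

definition hausdorff :: "nat \<Rightarrow> 'a::metric_space measure" where
  "hausdorff d =
     measure_of UNIV (lambda_system UNIV (Pow UNIV) (hausdorff_outer d)) (hausdorff_outer d)"

definition Lp_on ::
  "nat \<Rightarrow> real \<Rightarrow> 'a::euclidean_space set \<Rightarrow> ('a \<Rightarrow> 'b::{banach, second_countable_topology}) \<Rightarrow> bool"
where
  "Lp_on d r S w \<longleftrightarrow>
     set_borel_measurable (hausdorff d) S w \<and>
     set_integrable (hausdorff d) S (\<lambda>x. norm (w x) powr r)"

definition surface_div :: "('a::euclidean_space \<Rightarrow> 'a) \<Rightarrow> ('a \<Rightarrow> 'a) \<Rightarrow> 'a \<Rightarrow> real" where
  "surface_div \<nu> X x =
     (\<Sum>e\<in>Basis. frechet_derivative X (at x) e \<bullet> e) - frechet_derivative X (at x) (\<nu> x) \<bullet> \<nu> x"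

text \<open>\<open>W\<^sup>1\<^sup>,\<^sup>r(S)\<close>: \<open>G\<close> is the weak tangential gradient, tested with smooth tangential
  vector fields whose support on \<open>S\<close> is compact and does not meet the boundary. For \<open>r > d\<close> a class in
  \<open>W\<^sup>1\<^sup>,\<^sup>r(S)\<close> has a representative continuous on \<open>S\<close>, whose restriction to the boundary is the trace.\<close>

definition sobolev1_on ::
  "nat \<Rightarrow> real \<Rightarrow> 'a::euclidean_space set \<Rightarrow> ('a \<Rightarrow> 'a) \<Rightarrow> ('a \<Rightarrow> real) \<Rightarrow> bool" where
  "sobolev1_on d r S \<nu> w \<longleftrightarrow>
     Lp_on d r S w \<and>
     (\<exists>G. Lp_on d r S G \<and> (\<forall>x\<in>S. G x \<bullet> \<nu> x = 0) \<and>
        (\<forall>X. smooth_on UNIV X \<and> (\<forall>x\<in>S. X x \<bullet> \<nu> x = 0) \<and>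
             (\<exists>K. compact K \<and> K \<subseteq> S - mfd_boundary S \<and> (\<forall>x\<in>S - K. X x = 0)) \<longrightarrow>
          (LINT x:S|hausdorff d. w x * surface_div \<nu> X x) = - (LINT x:S|hausdorff d. G x \<bullet> X x)))"


section \<open>Triangulated surfaces and piecewise linear functions\<close>

definition mesh_vertices :: "'a::euclidean_space set set \<Rightarrow> 'a set" where
  "mesh_vertices \<T> = {B. \<exists>T\<in>\<T>. B extreme_point_of T}"

definition mesh_boundary :: "'a::euclidean_space set set \<Rightarrow> 'a set" where
  "mesh_boundary \<T> = \<Union>{F. \<exists>!T. T \<in> \<T> \<and> F facet_of T}"

definition inner_vertices :: "'a::euclidean_space set set \<Rightarrow> 'a set" where
  "inner_vertices \<T> = mesh_vertices \<T> - mesh_boundary \<T>"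

definition boundary_vertices :: "'a::euclidean_space set set \<Rightarrow> 'a set" where
  "boundary_vertices \<T> = mesh_vertices \<T> \<inter> mesh_boundary \<T>"

text \<open>Extended by \<open>0\<close> off the polyhedral surface, which makes the nodal basis function unique
  as a function on the whole space.\<close>

definition hat :: "'a::euclidean_space set set \<Rightarrow> 'a \<Rightarrow> 'a \<Rightarrow> real" where
  "hat \<T> B = (THE \<phi>.
     continuous_on (\<Union>\<T>) \<phi> \<and>
     (\<forall>T\<in>\<T>. \<exists>a k. \<forall>x\<in>T. \<phi> x = a \<bullet> x + k) \<and>
     (\<forall>B'\<in>mesh_vertices \<T>. \<phi> B' = (if B' = B then 1 else 0)) \<and>
     (\<forall>x. x \<notin> \<Union>\<T> \<longrightarrow> \<phi> x = 0))"

definition hat_support :: "'a::euclidean_space set set \<Rightarrow> 'a \<Rightarrow> 'a set" where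
  "hat_support \<T> B = closure {x \<in> \<Union>\<T>. hat \<T> B x \<noteq> 0}"

definition fe_space :: "'a::euclidean_space set set \<Rightarrow> ('a \<Rightarrow> real) set" where
  "fe_space \<T> = {\<lambda>x. \<Sum>B\<in>mesh_vertices \<T>. c B * hat \<T> B x |c. True}"

definition fe_space0 :: "'a::euclidean_space set set \<Rightarrow> ('a \<Rightarrow> real) set" where
  "fe_space0 \<T> = {\<lambda>x. \<Sum>B\<in>inner_vertices \<T>. c B * hat \<T> B x |c. True}"

definition boundary_interp :: "'a::euclidean_space set set \<Rightarrow> ('a \<Rightarrow> real) \<Rightarrow> 'a \<Rightarrow> real" where
  "boundary_interp \<T> g x = (\<Sum>B\<in>boundary_vertices \<T>. g B * hat \<T> B x)"

text \<open>\<open>\<nabla>\<phi> - (\<nabla>\<phi> \<cdot> \<nu>\<^sub>h) \<nu>\<^sub>h\<close> for \<open>\<phi>\<close> affine on the simplex \<open>T\<close> of codimension 1, with unit normal \<open>n = \<nu>\<^sub>h\<close>;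
  the value depends neither on the affine extension of \<open>\<phi>\<close> off \<open>T\<close> nor on the sign of \<open>n\<close>.\<close>

definition simplex_grad :: "'a::euclidean_space set \<Rightarrow> ('a \<Rightarrow> real) \<Rightarrow> 'a" where
  "simplex_grad T \<phi> = (THE w. \<exists>a k n.
     (\<forall>x\<in>T. \<phi> x = a \<bullet> x + k) \<and>
     norm n = 1 \<and> (\<forall>x\<in>T. \<forall>y\<in>T. n \<bullet> (x - y) = 0) \<and>
     w = a - (a \<bullet> n) *\<^sub>R n)"

text \<open>Elementwise gradient; the value \<open>0\<close> on the interfaces between simplices is a convention on
  a null set.\<close>

definition mesh_grad :: "'a::euclidean_space set set \<Rightarrow> ('a \<Rightarrow> real) \<Rightarrow> 'a \<Rightarrow> 'a" where
  "mesh_grad \<T> \<phi> x =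
     (if \<exists>T\<in>\<T>. x \<in> rel_interior T
      then simplex_grad (THE T. T \<in> \<T> \<and> x \<in> rel_interior T) \<phi> else 0)"

text \<open>Being a bijection, the normal projection excludes in particular that the polyhedral surface
  is a double covering of \<open>S\<close>. The inradius of \<open>T\<close> is taken within its affine hull.\<close>

definition admissible_mesh ::
  "nat \<Rightarrow> 'a::euclidean_space set \<Rightarrow> ('a \<Rightarrow> 'a) \<Rightarrow> real \<Rightarrow> ('a \<Rightarrow> real) \<Rightarrow> real \<Rightarrow> real \<Rightarrow> 'a set set \<Rightarrow> bool"
where
  "admissible_mesh d S \<nu> \<epsilon> \<delta> c h \<T> \<longleftrightarrow>
     triangulation \<T> \<and> \<T> \<noteq> {} \<and> (\<forall>T\<in>\<T>. int d simplex T) \<and>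
     h = Max (diameter ` \<T>) \<and>
     (\<forall>T\<in>\<T>. \<exists>x\<in>T. cball x (c * h) \<inter> affine hull T \<subseteq> T) \<and>
     mesh_vertices \<T> \<subseteq> S \<and>
     boundary_vertices \<T> \<noteq> {} \<and> boundary_vertices \<T> \<subseteq> mfd_boundary S \<and>
     \<Union>\<T> \<subseteq> tube S \<nu> \<epsilon> \<and>
     bij_betw (nproj S \<nu> \<delta>) (\<Union>\<T>) S \<and>
     nproj S \<nu> \<delta> ` mesh_boundary \<T> = mfd_boundary S"

definition mesh_lift ::
  "'a::euclidean_space set \<Rightarrow> ('a \<Rightarrow> 'a) \<Rightarrow> ('a \<Rightarrow> real) \<Rightarrow> 'a set set \<Rightarrow> ('a \<Rightarrow> real) \<Rightarrow> 'a \<Rightarrow> real" where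
  "mesh_lift S \<nu> \<delta> \<T> \<eta> y = \<eta> (the_inv_into (\<Union>\<T>) (nproj S \<nu> \<delta>) y)"


section \<open>The discrete problem\<close>

definition discrete_solution ::
  "nat \<Rightarrow> 'a::euclidean_space set \<Rightarrow> ('a \<Rightarrow> 'a) \<Rightarrow> ('a \<Rightarrow> real) \<Rightarrow>
   ('a \<Rightarrow> real \<Rightarrow> 'a \<Rightarrow> real) \<Rightarrow> ('a \<Rightarrow> real \<Rightarrow> real) \<Rightarrow> ('a \<Rightarrow> real) \<Rightarrow> ('a \<Rightarrow> real) \<Rightarrow>
   'a set set \<Rightarrow> ('a \<Rightarrow> real) \<Rightarrow> bool"
where
  "discrete_solution d S \<nu> \<delta> b q f g \<T> u \<longleftrightarrow>
     (let P = nproj S \<nu> \<delta> in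
      u \<in> fe_space \<T> \<and> (\<lambda>x. u x - boundary_interp \<T> g x) \<in> fe_space0 \<T> \<and>
      (\<forall>v\<in>fe_space0 \<T>.
        (LINT x:\<Union>\<T>|hausdorff d.
           b (P x) (u x) (mesh_grad \<T> u x) * (mesh_grad \<T> u x \<bullet> mesh_grad \<T> v x)
           + (q (P x) (u x) - q (P x) 0) * v x)
        = (LINT x:\<Union>\<T>|hausdorff d. (f (P x) - q (P x) 0) * v x)))"

text \<open>\<open>rpow\<close> has \<open>0\<^sup>0 = 1\<close>, unlike \<open>powr\<close>; this matters for \<open>\<bar>\<xi>\<bar>\<^sup>p\<^sup>-\<^sup>2\<close> when \<open>p = 2\<close>.\<close>

definition rpow :: "real \<Rightarrow> real \<Rightarrow> real" where
  "rpow t a = (if a = 0 then 1 else t powr a)"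

definition max_on :: "'a set \<Rightarrow> ('a \<Rightarrow> real) \<Rightarrow> real" where
  "max_on A w = (GREATEST m. m \<in> w ` A)"

end

theory Submission
  imports Defs
begin

text \<open>
  Let \<open>k\<close> be the maximum of \<open>g\<close> at the boundary vertices of a mesh. The idea is to test the discrete
  equation with the function \<open>v\<close> that has the nodal values \<open>max (u B - k) 0\<close>. It vanishes at the boundary
  vertices, so it is admissible. Two signs are immediate: \<open>q x z - q x 0\<close> and \<open>v\<close> are nonnegative, hence so
  is the reaction term, and \<open>f - q x 0 \<le> 0\<close> makes the right-hand side nonpositive. The diffusion term is
  where the acuteness of the mesh enters. Since the basis functions sum up to \<open>1\<close>, subtracting \<open>k\<close> from
  the nodal values of \<open>u\<close> does not change its gradient. The positive and the negative part of \<open>u B - k\<close>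
  are never nonzero at the same vertex, so their gradients are coupled only through products of the
  gradients of different basis functions, one of them belonging to an inner vertex. These products are
  nonpositive, and therefore the product of the gradients of \<open>u\<close> and \<open>v\<close> is at least \<open>\<bar>\<nabla>v\<bar>\<^sup>2\<close> on every simplex
  (\<open>grad_positive_part_le\<close>). With the lower bound \<open>\<mu>0\<close> of the diffusion coefficient, the equation
  forces \<open>\<nabla>v = 0\<close> on every simplex. So \<open>v\<close> is constant on every simplex and, being continuous, on every component
  of the polyhedral surface. The normal projection is a homeomorphism onto \<open>S\<close>, every component of \<open>S\<close>
  meets the boundary, and \<open>v\<close> vanishes there. Thus \<open>v = 0\<close>, that is, \<open>u \<le> k\<close>
  (\<open>discrete_solution_le_boundary_values\<close>). Since \<open>u\<close> and the interpolated boundary values both attain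
  \<open>k\<close> at a boundary vertex, all three claims follow.

  Two points of this argument concern the measure. First, the integrals must be genuine: the integrand on the left is
  bounded and piecewise continuous, so it is integrable as soon as Borel sets are measurable for the
  Hausdorff measure, which follows from Caratheodory's criterion for metric outer measures
  (\<open>metric_outer_measure_split_closed\<close>).

  Second, the sign of \<open>f - q x 0\<close> is given almost everywhere on \<open>S\<close> and must be carried over to the
  polyhedral surface. This is where \<open>h\<close> has to be small. The vertices of a simplex lie on \<open>S\<close>, and secants
  of \<open>S\<close> of length \<open>h\<close> deviate from the tangent plane by \<open>o(h)\<close> only, uniformly on \<open>S\<close>
  (\<open>unit_normal_secant\<close>). As the inradius is at least \<open>c h\<close>, the plane of a small simplex is nearly
  tangential (\<open>simplex_normal_close\<close>), so on the simplex the normal projection has a Lipschitz inverse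
  (\<open>nproj_expanding_on_fine_mesh\<close>). Lipschitz maps preserve null sets.
\<close>

section \<open>Hausdorff measure\<close>

lemma hausdorff_pre_le:
  assumes "A \<subseteq> (\<Union>i. C i)" "\<And>i. bounded (C i)" "\<And>i. diameter (C i) \<le> r"
  shows "hausdorff_pre d r A \<le> (\<Sum>i. ennreal (unit_ball_vol (real d) * (diameter (C i) / 2) ^ d))"
  unfolding hausdorff_pre_def by (rule INF_lower) (use assms in auto)

lemma hausdorff_pre_less_obtain:
  assumes "hausdorff_pre d r A < t"
  obtains C :: "nat \<Rightarrow> 'a::metric_space set"
  where "A \<subseteq> (\<Union>i. C i)" "\<And>i. bounded (C i)" "\<And>i. diameter (C i) \<le> r"
    "(\<Sum>i. ennreal (unit_ball_vol (real d) * (diameter (C i) / 2) ^ d)) < t"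
proof -
  obtain C where "C \<in> {C :: nat \<Rightarrow> 'a set. A \<subseteq> (\<Union>i. C i) \<and> (\<forall>i. bounded (C i) \<and> diameter (C i) \<le> r)}"
    "(\<Sum>i. ennreal (unit_ball_vol (real d) * (diameter (C i) / 2) ^ d)) < t"
    using assms unfolding hausdorff_pre_def INF_less_iff by blast
  then show thesis using that by blast
qed

lemma hausdorff_pre_mono:
  assumes "A \<subseteq> B"
  shows "hausdorff_pre d r A \<le> hausdorff_pre d r B"
  unfolding hausdorff_pre_def by (rule INF_superset_mono) (use assms in auto)

lemma hausdorff_pre_antimono:
  assumes "r \<le> r'"
  shows "hausdorff_pre d r' A \<le> hausdorff_pre d r A"
  unfolding hausdorff_pre_def by (rule INF_superset_mono) (use assms in \<open>auto intro: order_trans\<close>)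

lemma hausdorff_pre_le_outer: "0 < r \<Longrightarrow> hausdorff_pre d r A \<le> hausdorff_outer d A"
  unfolding hausdorff_outer_def by (rule SUP_upper) auto

lemma hausdorff_outer_leI: "(\<And>r. 0 < r \<Longrightarrow> hausdorff_pre d r A \<le> t) \<Longrightarrow> hausdorff_outer d A \<le> t"
  unfolding hausdorff_outer_def by (rule SUP_least) auto

lemma hausdorff_outer_mono: "A \<subseteq> B \<Longrightarrow> hausdorff_outer d A \<le> hausdorff_outer d B"
  by (rule hausdorff_outer_leI) (meson hausdorff_pre_le_outer hausdorff_pre_mono order_trans)

lemma hausdorff_outer_empty:
  assumes "1 \<le> d"
  shows "hausdorff_outer d ({} :: 'a::metric_space set) = 0"
proof -
  have "hausdorff_pre d r ({} :: 'a set) \<le> 0" if "0 < r" for r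
    using hausdorff_pre_le[of "{} :: 'a set" "\<lambda>_. {}" r d] that assms by (simp add: power_0_left)
  then show ?thesis
    using hausdorff_outer_leI[of d "{} :: 'a set" 0] by simp
qed

text \<open>Covers of the single sets, each within \<open>e / 2 ^ (n + 1)\<close> of the infimum, are merged into one
  sequence by the pairing function on the natural numbers.\<close>

lemma hausdorff_pre_UN_le:
  fixes A :: "nat \<Rightarrow> 'a::metric_space set"
  shows "hausdorff_pre d r (\<Union>n. A n) \<le> (\<Sum>n. hausdorff_pre d r (A n))"
proof (cases "\<exists>n. hausdorff_pre d r (A n) = \<infinity>")
  case True
  then obtain n where n: "hausdorff_pre d r (A n) = \<infinity>" by blast
  have "hausdorff_pre d r (A n) \<le> (\<Sum>n. hausdorff_pre d r (A n))"
    using sum_le_suminf[of "\<lambda>n. hausdorff_pre d r (A n)" "{n}"] by (auto simp: summableI)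
  then show ?thesis using n by (simp add: top_unique)
next
  case False
  show ?thesis
  proof (rule ennreal_le_epsilon)
    fix e :: real assume e: "0 < e"
    define w where "w C = ennreal (unit_ball_vol (real d) * (diameter C / 2) ^ d)" for C :: "'a set"
    have "\<exists>C. A n \<subseteq> (\<Union>i. C i) \<and> (\<forall>i. bounded (C i) \<and> diameter (C i) \<le> r)
        \<and> (\<Sum>i. w (C i)) < hausdorff_pre d r (A n) + ennreal (e * (1/2)^Suc n)" for n
    proof -
      have "hausdorff_pre d r (A n) < hausdorff_pre d r (A n) + ennreal (e * (1/2)^Suc n)"
        using False e by (auto simp: ennreal_lessI less_top[symmetric])
      then show ?thesis
        by (rule hausdorff_pre_less_obtain) (auto simp: w_def)
    qed
    then obtain C where C: "\<And>n. A n \<subseteq> (\<Union>i. C n i)" "\<And>n i. bounded (C n i)"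
      "\<And>n i. diameter (C n i) \<le> r"
      "\<And>n. (\<Sum>i. w (C n i)) < hausdorff_pre d r (A n) + ennreal (e * (1/2)^Suc n)"
      by metis
    define D where "D k = (case prod_decode k of (n, i) \<Rightarrow> C n i)" for k
    have "(\<Union>n. A n) \<subseteq> (\<Union>k. D k)"
    proof
      fix x assume "x \<in> (\<Union>n. A n)"
      then obtain n i where "x \<in> C n i" using C(1) by blast
      then have "x \<in> D (prod_encode (n, i))" by (simp add: D_def)
      then show "x \<in> (\<Union>k. D k)" by blast
    qed
    then have "hausdorff_pre d r (\<Union>n. A n) \<le> (\<Sum>k. w (D k))"
      unfolding w_def by (rule hausdorff_pre_le) (auto simp: D_def C split: prod.split)
    also have "\<dots> = (\<Sum>k. (\<lambda>(n, i). w (C n i)) (prod_decode k))"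
      by (auto simp: D_def split: prod.split intro!: suminf_cong)
    also have "\<dots> = (\<Sum>n. \<Sum>i. w (C n i))"
      by (rule suminf_ennreal_2dimen) simp
    also have "\<dots> \<le> (\<Sum>n. hausdorff_pre d r (A n) + ennreal (e * (1/2)^Suc n))"
      by (intro suminf_le summableI) (use C(4) in \<open>auto intro: less_imp_le\<close>)
    also have "\<dots> = (\<Sum>n. hausdorff_pre d r (A n)) + (\<Sum>n. ennreal (e * (1/2)^Suc n))"
      by (intro suminf_add[symmetric] summableI)
    also have "(\<Sum>n. ennreal (e * (1/2)^Suc n)) = ennreal e"
    proof -
      have "(\<lambda>n. e * (1/2)^Suc n) sums (e * 1)"
        by (intro sums_mult power_half_series)
      then show ?thesis
        using e by (subst suminf_ennreal2) (auto simp: sums_iff)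
    qed
    finally show "hausdorff_pre d r (\<Union>n. A n) \<le> (\<Sum>n. hausdorff_pre d r (A n)) + ennreal e" .
  qed
qed

lemma hausdorff_outer_UN_le:
  fixes A :: "nat \<Rightarrow> 'a::metric_space set"
  shows "hausdorff_outer d (\<Union>n. A n) \<le> (\<Sum>n. hausdorff_outer d (A n))"
proof (rule hausdorff_outer_leI)
  fix r :: real assume r: "0 < r"
  have "hausdorff_pre d r (\<Union>n. A n) \<le> (\<Sum>n. hausdorff_pre d r (A n))"
    by (rule hausdorff_pre_UN_le)
  also have "\<dots> \<le> (\<Sum>n. hausdorff_outer d (A n))"
    by (intro suminf_le summableI hausdorff_pre_le_outer r)
  finally show "hausdorff_pre d r (\<Union>n. A n) \<le> (\<Sum>n. hausdorff_outer d (A n))" .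
qed

lemma outer_measure_space_hausdorff:
  assumes "1 \<le> d"
  shows "outer_measure_space (Pow UNIV) (hausdorff_outer d :: 'a::metric_space set \<Rightarrow> ennreal)"
  unfolding outer_measure_space_def positive_def increasing_def countably_subadditive_def
  by (auto simp: hausdorff_outer_empty[OF assms] intro: hausdorff_outer_mono hausdorff_outer_UN_le)

lemma hausdorff_outer_Un_le:
  assumes "1 \<le> d"
  shows "hausdorff_outer d (A \<union> B) \<le> hausdorff_outer d A + hausdorff_outer d (B :: 'a::metric_space set)"
proof -
  define C where "C n = (if n = 0 then A else if n = Suc 0 then B else {})" for n :: nat
  have "A \<union> B \<subseteq> (\<Union>n. C n)"
    by (auto simp: C_def split: if_splits)
  then have "hausdorff_outer d (A \<union> B) \<le> (\<Sum>n. hausdorff_outer d (C n))"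
    by (rule order_trans[OF hausdorff_outer_mono hausdorff_outer_UN_le])
  also have "\<dots> = (\<Sum>n\<in>{0, Suc 0}. hausdorff_outer d (C n))"
    by (rule suminf_finite) (auto simp: C_def hausdorff_outer_empty[OF assms])
  finally show ?thesis by (simp add: C_def)
qed

text \<open>A set of diameter below \<open>\<rho>\<close> cannot meet both \<open>A\<close> and \<open>B\<close>, so that a fine cover of the union splits
  into a cover of \<open>A\<close> and one of \<open>B\<close>.\<close>

lemma hausdorff_outer_Un_separated:
  fixes A B :: "'a::metric_space set"
  assumes "1 \<le> d" "0 < \<rho>" and sep: "\<And>x y. x \<in> A \<Longrightarrow> y \<in> B \<Longrightarrow> \<rho> \<le> dist x y"
  shows "hausdorff_outer d (A \<union> B) = hausdorff_outer d A + hausdorff_outer d B"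
proof (rule antisym)
  show "hausdorff_outer d (A \<union> B) \<le> hausdorff_outer d A + hausdorff_outer d B"
    by (rule hausdorff_outer_Un_le[OF assms(1)])
  have key: "hausdorff_pre d r A + hausdorff_pre d r B \<le> hausdorff_pre d r (A \<union> B)"
    if r: "0 < r" "r < \<rho>" for r
    unfolding hausdorff_pre_def[of d r "A \<union> B"]
  proof (rule INF_greatest, clarify)
    fix C :: "nat \<Rightarrow> 'a set"
    assume C: "A \<union> B \<subseteq> (\<Union>i. C i)" and b: "\<forall>i. bounded (C i) \<and> diameter (C i) \<le> r"
    define w where "w C = ennreal (unit_ball_vol (real d) * (diameter C / 2) ^ d)" for C :: "'a set"
    have w0: "w {} = 0" using assms(1) by (simp add: w_def power_0_left)
    define CA CB where "CA i = (if C i \<inter> A = {} then {} else C i)"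
      and "CB i = (if C i \<inter> A = {} then C i else {})" for i
    have "B \<inter> C i = {}" if i: "C i \<inter> A \<noteq> {}" for i
    proof (rule ccontr)
      assume "B \<inter> C i \<noteq> {}"
      then obtain x y where xy: "x \<in> A" "y \<in> B" "x \<in> C i" "y \<in> C i" using i by blast
      then have "dist x y \<le> diameter (C i)" using b by (blast intro: diameter_bounded_bound)
      then show False using sep[OF xy(1,2)] b r by (smt (verit))
    qed
    note sepC = this
    have "B \<subseteq> (\<Union>i. CB i)"
    proof
      fix y assume y: "y \<in> B"
      then obtain i where i: "y \<in> C i" using C by blast
      then have "y \<in> CB i" using sepC[of i] y by (auto simp: CB_def)
      then show "y \<in> (\<Union>i. CB i)" by blast
    qed
    then have "hausdorff_pre d r B \<le> (\<Sum>i. w (CB i))" unfolding w_def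
      by (rule hausdorff_pre_le) (use b r in \<open>auto simp: CB_def\<close>)
    moreover have "A \<subseteq> (\<Union>i. CA i)"
    proof
      fix x assume x: "x \<in> A"
      then obtain i where i: "x \<in> C i" using C by blast
      then have "x \<in> CA i" using x by (auto simp: CA_def)
      then show "x \<in> (\<Union>i. CA i)" by blast
    qed
    then have "hausdorff_pre d r A \<le> (\<Sum>i. w (CA i))" unfolding w_def
      by (rule hausdorff_pre_le) (use b r in \<open>auto simp: CA_def\<close>)
    ultimately have "hausdorff_pre d r A + hausdorff_pre d r B \<le> (\<Sum>i. w (CA i)) + (\<Sum>i. w (CB i))"
      by (rule add_mono[rotated])
    also have "\<dots> = (\<Sum>i. w (CA i) + w (CB i))" by (intro suminf_add summableI)
    also have "\<dots> = (\<Sum>i. w (C i))" by (rule suminf_cong) (auto simp: CA_def CB_def w0)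
    finally show "hausdorff_pre d r A + hausdorff_pre d r B
      \<le> (\<Sum>i. ennreal (unit_ball_vol (real d) * (diameter (C i) / 2) ^ d))" by (simp add: w_def)
  qed
  have "hausdorff_pre d r A + hausdorff_pre d s B \<le> hausdorff_outer d (A \<union> B)"
    if "0 < r" "0 < s" for r s
  proof -
    define t where "t = min (\<rho>/2) (min r s)"
    have t: "0 < t" "t < \<rho>" "t \<le> r" "t \<le> s" using that assms(2) by (auto simp: t_def)
    have "hausdorff_pre d r A + hausdorff_pre d s B \<le> hausdorff_pre d t A + hausdorff_pre d t B"
      by (intro add_mono hausdorff_pre_antimono t)
    also have "\<dots> \<le> hausdorff_pre d t (A \<union> B)" by (rule key[OF t(1,2)])
    also have "\<dots> \<le> hausdorff_outer d (A \<union> B)" by (rule hausdorff_pre_le_outer[OF t(1)])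
    finally show ?thesis .
  qed
  note * = this
  have ne: "{0::real<..} \<noteq> {}" using gt_ex[of "0::real"] by blast
  have "hausdorff_outer d A + hausdorff_pre d s B \<le> hausdorff_outer d (A \<union> B)" if "0 < s" for s
    unfolding hausdorff_outer_def[of d A]
    by (subst ennreal_SUP_add_left[OF ne, symmetric], rule SUP_least) (use * that in auto)
  note ** = this
  show "hausdorff_outer d A + hausdorff_outer d B \<le> hausdorff_outer d (A \<union> B)"
    unfolding hausdorff_outer_def[of d B]
    by (subst ennreal_SUP_add_right[OF ne], rule SUP_least) (use ** in auto)
qed

text \<open>Caratheodory's criterion. The points of \<open>A\<close> at distance at least \<open>1 / (n + 1)\<close> from \<open>F\<close> are separated
  from \<open>F\<close>, so their outer measure adds up with that of \<open>A \<inter> F\<close>. The rest of \<open>A - F\<close> is covered by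
  shells around \<open>F\<close>. Shells that are not neighbours are separated, so the outer measures of the even and of
  the odd shells sum up to at most \<open>\<mu> A\<close> each, and the tail of the series becomes arbitrarily small.\<close>

lemma metric_outer_measure_split_closed:
  fixes \<mu> :: "'a::metric_space set \<Rightarrow> ennreal"
  assumes om: "outer_measure_space (Pow UNIV) \<mu>"
    and sep: "\<And>A B \<rho>. 0 < \<rho> \<Longrightarrow> (\<And>x y. x \<in> A \<Longrightarrow> y \<in> B \<Longrightarrow> \<rho> \<le> dist x y) \<Longrightarrow> \<mu> (A \<union> B) = \<mu> A + \<mu> B"
    and F: "closed F"
  shows "\<mu> (A \<inter> F) + \<mu> (A - F) \<le> \<mu> A"
proof -
  have empty: "\<mu> {} = 0" using om by (simp add: outer_measure_space_def positive_def)
  have mono: "X \<subseteq> Y \<Longrightarrow> \<mu> X \<le> \<mu> Y" for X Y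
    using om by (simp add: outer_measure_space_def increasing_def)
  have UN_le: "\<mu> (\<Union>n. X n) \<le> (\<Sum>n. \<mu> (X n))" if "disjoint_family X" for X :: "nat \<Rightarrow> 'a set"
    using om that by (simp add: outer_measure_space_def countably_subadditive_def)
  consider "\<mu> A = \<infinity>" | "F = {}" | "\<mu> A < \<infinity>" "F \<noteq> {}"
    by (cases "\<mu> A = \<infinity>"; cases "F = {}") (auto simp: less_top[symmetric])
  then show ?thesis
  proof cases
    case 3
    define E where "E n = {x\<in>A. 1 / real (Suc n) \<le> infdist x F}" for n
    \<comment> \<open>The shell of points with distance in \<open>[1 / (n + 2), 1 / (n + 1))\<close> from \<open>F\<close>.\<close>
    define D where "D n = E (Suc n) - E n" for n
    have E_mono: "E m \<subseteq> E n" if "m \<le> n" for m n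
    proof -
      have "1 / real (Suc n) \<le> 1 / real (Suc m)" using that by (simp add: frac_le)
      then show ?thesis by (auto simp: E_def)
    qed
    have E_sep: "\<mu> (A \<inter> F) + \<mu> (E n) \<le> \<mu> A" for n
    proof -
      have "\<mu> ((A \<inter> F) \<union> E n) = \<mu> (A \<inter> F) + \<mu> (E n)"
      proof (rule sep)
        show "0 < 1 / real (Suc n)" by simp
        fix x y assume "x \<in> A \<inter> F" "y \<in> E n"
        then show "1 / real (Suc n) \<le> dist x y"
          using infdist_le[of x F y] by (simp add: E_def dist_commute)
      qed
      moreover have "\<mu> ((A \<inter> F) \<union> E n) \<le> \<mu> A" by (rule mono) (auto simp: E_def)
      ultimately show ?thesis by simp
    qed
    \<comment> \<open>The even shells for \<open>p = 0\<close>, the odd ones for \<open>p = 1\<close>.\<close>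
    have partial: "(\<Sum>k<n. \<mu> (D (2*k+p))) = \<mu> (\<Union>k<n. D (2*k+p))" for n p
    proof (induction n)
      case 0
      then show ?case by (simp add: empty)
    next
      case (Suc n)
      have "\<mu> ((\<Union>k<n. D (2*k+p)) \<union> D (2*n+p)) = \<mu> (\<Union>k<n. D (2*k+p)) + \<mu> (D (2*n+p))"
      proof (cases "n = 0")
        case False
        show ?thesis
        proof (rule sep)
          show "0 < 1 / real (2*n+p) - 1 / real (Suc (2*n+p))"
            using False by (simp add: frac_less2)
          fix x y assume x: "x \<in> (\<Union>k<n. D (2*k+p))" and y: "y \<in> D (2*n+p)"
          obtain k where k: "k < n" "x \<in> D (2*k+p)" using x by blast
          then have "1 / real (Suc (Suc (2*k+p))) \<le> infdist x F" by (auto simp: D_def E_def)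
          moreover have "1 / real (2*n+p) \<le> 1 / real (Suc (Suc (2*k+p)))"
            using k(1) by (intro divide_left_mono) (auto simp flip: of_nat_mult)
          moreover have "infdist y F < 1 / real (Suc (2*n+p))"
            using y by (auto simp: D_def E_def)
          moreover have "infdist x F \<le> infdist y F + dist x y" by (rule infdist_triangle)
          ultimately show "1 / real (2*n+p) - 1 / real (Suc (2*n+p)) \<le> dist x y" by linarith
        qed
      qed (simp add: empty)
      then show ?case using Suc by (simp add: lessThan_Suc Un_commute add.commute)
    qed
    have partial_le: "(\<Sum>k<n. \<mu> (D (2*k+p))) \<le> \<mu> A" for n p
      unfolding partial by (rule mono) (auto simp: D_def E_def)
    have "(\<Sum>k<2*n. \<mu> (D k)) = (\<Sum>k<n. \<mu> (D (2*k+0))) + (\<Sum>k<n. \<mu> (D (2*k+1)))" for n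
      by (induction n) (auto simp: algebra_simps)
    then have "(\<Sum>k<2*n. \<mu> (D k)) \<le> \<mu> A + \<mu> A" for n
      using add_mono[OF partial_le[where n=n and p=0] partial_le[where n=n and p=1]] by simp
    moreover have "(\<Sum>k<n. \<mu> (D k)) \<le> (\<Sum>k<2*n. \<mu> (D k))" for n
      by (rule sum_mono2) auto
    ultimately have "(\<Sum>k. \<mu> (D k)) \<le> \<mu> A + \<mu> A"
      by (intro suminf_le_const summableI) (rule order_trans)
    then have fin: "(\<Sum>k. \<mu> (D k)) < \<infinity>"
      using 3(1) by (elim order_le_less_trans) (simp add: less_top[symmetric])
    have D_fin: "\<mu> (D k) < \<infinity>" for k
      by (rule order_le_less_trans[OF mono[of "D k" A] 3(1)]) (auto simp: D_def E_def)
    define a where "a k = enn2real (\<mu> (D k))" for k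
    have a: "\<mu> (D k) = ennreal (a k)" for k using D_fin by (simp add: a_def)
    have a0: "0 \<le> a k" for k by (simp add: a_def)
    have "summable a"
      by (rule summable_suminf_not_top[OF a0]) (use fin in \<open>simp add: a\<close>)
    show ?thesis
    proof (rule ennreal_le_epsilon)
      fix e :: real assume "0 < e"
      then obtain N where N: "norm (\<Sum>i. a (i + N)) < e"
        using suminf_exist_split[OF _ \<open>summable a\<close>] by blast
      define X where "X k = (if k = 0 then E N else D (k - 1 + N))" for k
      have "A - F \<subseteq> (\<Union>k. X k)"
      proof
        fix x assume x: "x \<in> A - F"
        then have "0 < infdist x F"
          using infdist_pos_not_in_closed[OF F 3(2)] by simp
        then obtain m where "1 / real (Suc m) < infdist x F"
          by (rule nat_approx_posE) (rule that)
        then have "x \<in> E m" using x by (simp add: E_def)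
        define l where "l = (LEAST m. x \<in> E m)"
        have l: "x \<in> E l" "\<And>m. x \<in> E m \<Longrightarrow> l \<le> m"
          unfolding l_def using LeastI[of "\<lambda>m. x \<in> E m" m] Least_le[of "\<lambda>m. x \<in> E m"] \<open>x \<in> E m\<close>
          by blast+
        show "x \<in> (\<Union>k. X k)"
        proof (cases "l \<le> N")
          case True
          then have "x \<in> X 0" using l(1) E_mono by (auto simp: X_def)
          then show ?thesis by blast
        next
          case False
          then have "x \<in> D (l - 1)" using l(1) l(2)[of "l - 1"] by (cases l) (auto simp: D_def)
          then have "x \<in> X (l - N)" using False by (simp add: X_def)
          then show ?thesis by blast
        qed
      qed
      then have "\<mu> (A - F) \<le> \<mu> (\<Union>k. X k)" by (rule mono)
      also have "\<dots> \<le> (\<Sum>k. \<mu> (X k))"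
      proof (rule UN_le)
        have *: "X i \<inter> X j = {}" if "i < j" for i j
        proof -
          have "X i \<subseteq> E (i + N)" by (cases i) (auto simp: X_def D_def)
          moreover have "E (i + N) \<subseteq> E (j - 1 + N)" using that by (intro E_mono) auto
          moreover have "X j \<inter> E (j - 1 + N) = {}" using that by (auto simp: X_def D_def)
          ultimately show ?thesis by blast
        qed
        have "X i \<inter> X j = {}" if "i \<noteq> j" for i j
          using *[of i j] *[of j i] that by (cases "i < j") auto
        then show "disjoint_family X" by (simp add: disjoint_family_on_def)
      qed
      also have "\<dots> = \<mu> (X 0) + (\<Sum>k. \<mu> (X (Suc k)))"
        using suminf_offset[of "\<lambda>k. \<mu> (X k)" 1] by (simp add: summableI)
      also have "(\<Sum>k. \<mu> (X (Suc k))) = ennreal (\<Sum>k. a (k + N))"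
        using \<open>summable a\<close> a0 by (simp add: X_def a suminf_ennreal2 summable_iff_shift)
      also have "\<dots> \<le> ennreal e" using N by (intro ennreal_leI) auto
      finally have "\<mu> (A - F) \<le> \<mu> (E N) + ennreal e" by (simp add: X_def)
      then have "\<mu> (A \<inter> F) + \<mu> (A - F) \<le> \<mu> (A \<inter> F) + (\<mu> (E N) + ennreal e)"
        by (rule add_left_mono)
      also have "\<dots> \<le> \<mu> A + ennreal e"
        unfolding add.assoc[symmetric] by (rule add_right_mono[OF E_sep])
      finally show "\<mu> (A \<inter> F) + \<mu> (A - F) \<le> \<mu> A + ennreal e" .
    qed
  qed (auto simp: empty)
qed

lemma lambda_system_hausdorffI:
  assumes "1 \<le> d" "\<And>A. hausdorff_outer d (A \<inter> F) + hausdorff_outer d (A - F) \<le> hausdorff_outer d (A :: 'a::metric_space set)"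
  shows "F \<in> lambda_system UNIV (Pow UNIV) (hausdorff_outer d)"
proof -
  interpret sigma_algebra UNIV "Pow (UNIV :: 'a set)" by (rule sigma_algebra_Pow)
  have "hausdorff_outer d A \<le> hausdorff_outer d (A \<inter> F) + hausdorff_outer d (A - F)" for A
    using hausdorff_outer_Un_le[OF assms(1), of "A \<inter> F" "A - F"] by (simp add: Int_Diff_Un)
  then show ?thesis using assms(2) by (auto simp: lambda_system_eq simp del: Pow_UNIV intro: antisym)
qed

lemma
  assumes d: "1 \<le> d"
  shows space_hausdorff: "space (hausdorff d :: 'a::metric_space measure) = UNIV"
    and sets_hausdorff: "sets (hausdorff d :: 'a measure) = lambda_system UNIV (Pow UNIV) (hausdorff_outer d)"
    and emeasure_hausdorff: "A \<in> sets (hausdorff d :: 'a measure) \<Longrightarrow> emeasure (hausdorff d) A = hausdorff_outer d A"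
proof -
  interpret sigma_algebra UNIV "Pow (UNIV :: 'a set)" by (rule sigma_algebra_Pow)
  have *: "measure_space UNIV (lambda_system UNIV (Pow UNIV) (hausdorff_outer d)) (hausdorff_outer d :: 'a set \<Rightarrow> ennreal)"
    by (rule caratheodory_lemma[OF outer_measure_space_hausdorff[OF d]])
  then interpret L: sigma_algebra UNIV "lambda_system UNIV (Pow UNIV) (hausdorff_outer d :: 'a set \<Rightarrow> ennreal)"
    by (simp add: measure_space_def)
  show "space (hausdorff d :: 'a measure) = UNIV" by (simp add: hausdorff_def)
  show s: "sets (hausdorff d :: 'a measure) = lambda_system UNIV (Pow UNIV) (hausdorff_outer d)"
    by (simp add: hausdorff_def L.sigma_sets_eq del: Pow_UNIV)
  show "emeasure (hausdorff d) A = hausdorff_outer d A" if "A \<in> sets (hausdorff d :: 'a measure)"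
    unfolding hausdorff_def
    by (rule emeasure_measure_of_sigma) (use * that in \<open>auto simp: measure_space_def s\<close>)
qed

lemma borel_subset_sets_hausdorff:
  assumes d: "1 \<le> d"
  shows "sets borel \<subseteq> sets (hausdorff d :: 'a::metric_space measure)"
proof -
  have "F \<in> sets (hausdorff d)" if "closed F" for F :: "'a set"
    unfolding sets_hausdorff[OF d]
    by (intro lambda_system_hausdorffI d metric_outer_measure_split_closed
        outer_measure_space_hausdorff hausdorff_outer_Un_separated that)
  then have "sigma_sets (space (hausdorff d)) (Collect closed) \<subseteq> sets (hausdorff d :: 'a measure)"
    by (intro sets.sigma_sets_subset) auto
  then show ?thesis
    by (simp add: borel_eq_closed space_hausdorff[OF d])
qed

lemma null_sets_hausdorff_iff:
  assumes d: "1 \<le> d"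
  shows "N \<in> null_sets (hausdorff d :: 'a::metric_space measure) \<longleftrightarrow> hausdorff_outer d N = 0"
proof
  assume "N \<in> null_sets (hausdorff d)"
  then show "hausdorff_outer d N = 0" by (auto simp: null_sets_def emeasure_hausdorff[OF d])
next
  assume 0: "hausdorff_outer d N = 0"
  have "hausdorff_outer d (A \<inter> N) + hausdorff_outer d (A - N) \<le> hausdorff_outer d A" for A
  proof -
    have "hausdorff_outer d (A \<inter> N) \<le> 0" unfolding 0[symmetric] by (rule hausdorff_outer_mono) auto
    then show ?thesis by (simp add: hausdorff_outer_mono)
  qed
  then have "N \<in> sets (hausdorff d)"
    unfolding sets_hausdorff[OF d] by (rule lambda_system_hausdorffI[OF d])
  then show "N \<in> null_sets (hausdorff d)" using 0 by (simp add: null_sets_def emeasure_hausdorff[OF d])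
qed

text \<open>The images of the members of a cover form a cover of the image, and their diameters grow at most by
  the factor \<open>L\<close>.\<close>

lemma hausdorff_outer_Lipschitz_null:
  fixes f :: "'a::metric_space \<Rightarrow> 'b::metric_space"
  assumes L: "0 < L" "\<And>x y. x \<in> A \<Longrightarrow> y \<in> A \<Longrightarrow> dist (f x) (f y) \<le> L * dist x y"
    and null: "hausdorff_outer d A = 0"
  shows "hausdorff_outer d (f ` A) = 0"
proof -
  have "hausdorff_pre d r (f ` A) \<le> 0 + ennreal e" if r: "0 < r" and e: "0 < e" for r e
  proof -
    have "hausdorff_pre d (r / L) A \<le> 0"
      unfolding null[symmetric] by (rule hausdorff_pre_le_outer) (use r L in simp)
    then have "hausdorff_pre d (r / L) A < ennreal (e / L ^ d)"
      by (rule order_le_less_trans) (use e L in simp)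
    then obtain C where C: "A \<subseteq> (\<Union>i. C i)" "\<And>i. bounded (C i)" "\<And>i. diameter (C i) \<le> r / L"
      "(\<Sum>i. ennreal (unit_ball_vol (real d) * (diameter (C i) / 2) ^ d)) < ennreal (e / L ^ d)"
      by (rule hausdorff_pre_less_obtain) (rule that)
    have dist_le: "dist (f x) (f y) \<le> L * diameter (C i)" if "x \<in> A \<inter> C i" "y \<in> A \<inter> C i" for x y i
    proof -
      have "dist x y \<le> diameter (C i)" using that C(2) by (blast intro: diameter_bounded_bound)
      then have "L * dist x y \<le> L * diameter (C i)" using L by simp
      then show ?thesis using L(2)[of x y] that by simp
    qed
    have diam: "diameter (f ` (A \<inter> C i)) \<le> L * diameter (C i)" for i
    proof (cases "A \<inter> C i = {}")
      case False
      then show ?thesis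
        unfolding diameter_def[of "f ` (A \<inter> C i)"] by (auto intro!: cSUP_least dist_le)
    next
      case True
      have "0 \<le> diameter (C i)" by (rule diameter_ge_0[OF C(2)])
      then show ?thesis using L by (simp add: True)
    qed
    have bdd: "bounded (f ` (A \<inter> C i))" for i
      unfolding bounded_two_points by (rule exI[of _ "L * diameter (C i)"]) (auto intro: dist_le)
    have "hausdorff_pre d r (f ` A)
        \<le> (\<Sum>i. ennreal (unit_ball_vol (real d) * (diameter (f ` (A \<inter> C i)) / 2) ^ d))"
    proof (rule hausdorff_pre_le)
      show "f ` A \<subseteq> (\<Union>i. f ` (A \<inter> C i))" using C(1) by blast
      show "bounded (f ` (A \<inter> C i))" for i by (rule bdd)
      show "diameter (f ` (A \<inter> C i)) \<le> r" for i
      proof -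
        have "L * diameter (C i) \<le> r" using C(3)[of i] L by (simp add: field_simps)
        then show ?thesis using diam[of i] by linarith
      qed
    qed
    also have "\<dots> \<le> (\<Sum>i. ennreal (L ^ d) * ennreal (unit_ball_vol (real d) * (diameter (C i) / 2) ^ d))"
    proof (intro suminf_le summableI)
      fix i
      have "(diameter (f ` (A \<inter> C i)) / 2) ^ d \<le> (L * diameter (C i) / 2) ^ d"
        using diam[of i] diameter_ge_0[OF bdd[of i]] by (intro power_mono) auto
      then have "unit_ball_vol (real d) * (diameter (f ` (A \<inter> C i)) / 2) ^ d
          \<le> L ^ d * (unit_ball_vol (real d) * (diameter (C i) / 2) ^ d)"
        using mult_left_mono[of "(diameter (f ` (A \<inter> C i)) / 2) ^ d" "(L * diameter (C i) / 2) ^ d"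
            "unit_ball_vol (real d)"]
        by (simp add: power_mult_distrib power_divide mult_ac)
      then show "ennreal (unit_ball_vol (real d) * (diameter (f ` (A \<inter> C i)) / 2) ^ d)
          \<le> ennreal (L ^ d) * ennreal (unit_ball_vol (real d) * (diameter (C i) / 2) ^ d)"
        using L by (simp add: ennreal_leI flip: ennreal_mult')
    qed
    also have "\<dots> = ennreal (L ^ d) * (\<Sum>i. ennreal (unit_ball_vol (real d) * (diameter (C i) / 2) ^ d))"
      by simp
    also have "\<dots> \<le> ennreal (L ^ d) * ennreal (e / L ^ d)"
      using C(4) by (intro mult_left_mono) auto
    also have "\<dots> = ennreal e" using L e by (simp flip: ennreal_mult')
    finally show ?thesis by simp
  qed
  then have "hausdorff_outer d (f ` A) \<le> 0"
    by (rule hausdorff_outer_leI[OF ennreal_le_epsilon])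
  then show ?thesis by simp
qed

section \<open>Affine functions and tangential gradients on simplices\<close>

lemma affine_nonneg_on_convex_hull:
  fixes a :: "'a::real_inner"
  assumes "\<And>v. v \<in> V \<Longrightarrow> 0 \<le> a \<bullet> v + k" "x \<in> convex hull V"
  shows "0 \<le> a \<bullet> x + k"
proof -
  have "convex hull V \<subseteq> {x. a \<bullet> x \<ge> - k}"
  proof (rule hull_minimal)
    show "V \<subseteq> {x. a \<bullet> x \<ge> - k}" using assms(1) by force
  qed (rule convex_halfspace_ge)
  then show ?thesis using assms(2) by force
qed

lemma affine_eq_on_convex_hull:
  fixes a :: "'a::real_inner"
  assumes "\<And>v. v \<in> V \<Longrightarrow> a \<bullet> v + k = a' \<bullet> v + k'" "x \<in> convex hull V"
  shows "a \<bullet> x + k = a' \<bullet> x + k'"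
proof -
  have "0 \<le> (a - a') \<bullet> x + (k - k')"
    by (rule affine_nonneg_on_convex_hull[OF _ assms(2)]) (use assms(1) in \<open>force simp: inner_diff_left\<close>)
  moreover have "0 \<le> (a' - a) \<bullet> x + (k' - k)"
    by (rule affine_nonneg_on_convex_hull[OF _ assms(2)]) (use assms(1) in \<open>force simp: inner_diff_left\<close>)
  ultimately show ?thesis by (simp add: inner_diff_left)
qed

text \<open>The segment from \<open>v\<close> to \<open>x\<close> can be prolonged beyond \<open>x\<close> within \<open>T\<close>, where the function is still
  nonnegative.\<close>

lemma affine_pos_on_rel_interior:
  fixes a :: "'a::euclidean_space"
  assumes "convex T" "\<And>y. y \<in> T \<Longrightarrow> 0 \<le> a \<bullet> y + k" "v \<in> T" "0 < a \<bullet> v + k" "x \<in> rel_interior T"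
  shows "0 < a \<bullet> x + k"
proof -
  obtain e where e: "e > 1" "(1 - e) *\<^sub>R v + e *\<^sub>R x \<in> T"
    using convex_rel_interior_iff[OF assms(1), of x] assms(3,5) by blast
  have "0 \<le> (1 - e) * (a \<bullet> v + k) + e * (a \<bullet> x + k)"
    using assms(2)[OF e(2)] by (simp add: inner_add_right algebra_simps)
  moreover have "(1 - e) * (a \<bullet> v + k) < 0"
    using e(1) assms(4) by (simp add: mult_neg_pos)
  ultimately have "0 < e * (a \<bullet> x + k)" by linarith
  then show ?thesis using e(1) by (simp add: zero_less_mult_iff)
qed

lemma affine_interpolation_exists:
  fixes V :: "'a::euclidean_space set"
  assumes "\<not> affine_dependent V"
  shows "\<exists>a k. \<forall>v\<in>V. a \<bullet> v + k = c v"
proof (cases "V = {}")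
  case False
  then obtain v0 where v0: "v0 \<in> V" by blast
  then have "independent ((\<lambda>x. -v0 + x) ` (V - {v0}))"
    using assms affine_dependent_iff_dependent2 by blast
  then obtain g :: "'a \<Rightarrow> real" where g: "linear g"
    "\<forall>x\<in>(\<lambda>x. -v0 + x) ` (V - {v0}). g x = c (v0 + x) - c v0"
    using linear_independent_extend[of _ "\<lambda>x. c (v0 + x) - c v0"] by blast
  have ad: "adjoint g 1 \<bullet> x = g x" for x
    using adjoint_works[OF g(1), of x 1] by (simp add: inner_commute)
  have "adjoint g 1 \<bullet> v + (c v0 - g v0) = c v" if "v \<in> V" for v
  proof (cases "v = v0")
    case False
    then have "g (-v0 + v) = c v - c v0" using g(2) that by force
    then show ?thesis using linear_add[OF g(1), of "-v0" v] linear_neg[OF g(1), of v0] by (simp add: ad)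
  qed (simp add: ad)
  then show ?thesis by blast
qed simp

text \<open>The last property expresses that the simplex has codimension 1: orthogonality to its edges
  determines a vector up to a factor.\<close>

lemma simplex_unit_normal:
  fixes T :: "'a::euclidean_space set"
  assumes T: "int d simplex T" and dim: "DIM('a) = d + 1"
  obtains n where "norm n = 1" "\<And>x y. x \<in> T \<Longrightarrow> y \<in> T \<Longrightarrow> n \<bullet> (x - y) = 0"
    "\<And>w. (\<And>x y. x \<in> T \<Longrightarrow> y \<in> T \<Longrightarrow> w \<bullet> (x - y) = 0) \<Longrightarrow> w = (w \<bullet> n) *\<^sub>R n"
proof -
  have "aff_dim T = int d" by (rule aff_dim_simplex[OF T])
  then have "T \<noteq> {}" by auto
  then obtain a where a: "a \<in> T" by blast
  define D where "D = (\<lambda>x. - a + x) ` T"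
  have dimD: "dim D = d"
    using aff_dim_eq_dim[of a T] a \<open>aff_dim T = int d\<close> by (simp add: D_def hull_inc)
  then obtain m where m: "m \<noteq> 0" "\<And>y. y \<in> span D \<Longrightarrow> orthogonal m y"
    using orthogonal_to_subspace_exists[of D] dim by auto
  define n where "n = m /\<^sub>R norm m"
  have n1: "norm n = 1" using m(1) by (simp add: n_def)
  have nD: "n \<bullet> y = 0" if "y \<in> span D" for y
    using m(2)[OF that] by (simp add: n_def orthogonal_def)
  have "span D = {x. n \<bullet> x = 0}"
  proof (rule subspace_dim_equal)
    show "subspace {x. n \<bullet> x = 0}" by (rule subspace_hyperplane)
    show "span D \<subseteq> {x. n \<bullet> x = 0}" using nD by blast
    have "n \<noteq> 0" using n1 by auto
    then show "dim {x. n \<bullet> x = 0} \<le> dim (span D)"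
      using dim_hyperplane[of n] dimD dim by simp
  qed simp
  have diff: "x - y \<in> span D" if "x \<in> T" "y \<in> T" for x y
  proof -
    have "(- a + x) - (- a + y) \<in> span D"
      using that by (intro span_diff span_base) (auto simp: D_def)
    then show ?thesis by simp
  qed
  show thesis
  proof (rule that[OF n1])
    show "n \<bullet> (x - y) = 0" if "x \<in> T" "y \<in> T" for x y using nD diff that by blast
    fix w assume w: "\<And>x y. x \<in> T \<Longrightarrow> y \<in> T \<Longrightarrow> w \<bullet> (x - y) = 0"
    define v where "v = w - (w \<bullet> n) *\<^sub>R n"
    have nn: "n \<bullet> n = 1" using n1 by (simp add: norm_eq_1)
    then have "n \<bullet> v = 0" by (simp add: v_def inner_diff_right inner_commute)
    then have "v \<in> span D" using \<open>span D = {x. n \<bullet> x = 0}\<close> by blast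
    moreover have "v \<bullet> y = 0" if y: "y \<in> D" for y
    proof -
      obtain x where "x \<in> T" "y = - a + x" using y unfolding D_def by blast
      then have "x \<in> T" "y = x - a" by simp_all
      then show ?thesis using w[of x a] a nD[of y] y
        by (auto simp: v_def inner_diff_left span_base)
    qed
    then have "span D \<subseteq> {y. v \<bullet> y = 0}"
      by (intro span_minimal subspace_hyperplane) blast
    ultimately have "v \<bullet> v = 0" by blast
    then show "w = (w \<bullet> n) *\<^sub>R n" by (simp add: v_def)
  qed
qed

text \<open>The unit normal is unique up to sign, so being orthogonal to one of them is the same as being
  tangential, and a tangential vector is determined by its products with the edges.\<close>

lemma simplex_grad_eqI:
  fixes T :: "'a::euclidean_space set"
  assumes T: "int d simplex T" and dim: "DIM('a) = d + 1"
    and n: "norm n = 1" "\<And>x y. x \<in> T \<Longrightarrow> y \<in> T \<Longrightarrow> n \<bullet> (x - y) = 0"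
    and w: "w \<bullet> n = 0" "\<And>x y. x \<in> T \<Longrightarrow> y \<in> T \<Longrightarrow> w \<bullet> (x - y) = \<phi> x - \<phi> y"
  shows "simplex_grad T \<phi> = w"
proof -
  obtain n0 where n0: "norm n0 = 1" "\<And>x y. x \<in> T \<Longrightarrow> y \<in> T \<Longrightarrow> n0 \<bullet> (x - y) = 0"
    "\<And>w. (\<And>x y. x \<in> T \<Longrightarrow> y \<in> T \<Longrightarrow> w \<bullet> (x - y) = 0) \<Longrightarrow> w = (w \<bullet> n0) *\<^sub>R n0"
    using simplex_unit_normal[OF T dim] by metis
  have perp: "v \<bullet> n0 = 0" if "norm m = 1" "\<And>x y. x \<in> T \<Longrightarrow> y \<in> T \<Longrightarrow> m \<bullet> (x - y) = 0" "v \<bullet> m = 0" for m v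
  proof -
    have m: "m = (m \<bullet> n0) *\<^sub>R n0" by (rule n0(3)) (rule that(2))
    then have "m \<bullet> n0 \<noteq> 0" using that(1) by fastforce
    moreover have "v \<bullet> m = (m \<bullet> n0) * (v \<bullet> n0)" by (subst m) simp
    ultimately show ?thesis using that(3) by simp
  qed
  have "T \<noteq> {}" using T aff_dim_simplex[OF T] by auto
  then obtain x0 where x0: "x0 \<in> T" by blast
  show ?thesis
    unfolding simplex_grad_def
  proof (rule the_equality)
    have "\<phi> x = w \<bullet> x + (\<phi> x0 - w \<bullet> x0)" if "x \<in> T" for x
      using w(2)[OF that x0] by (simp add: inner_diff_right)
    then show "\<exists>a k n. (\<forall>x\<in>T. \<phi> x = a \<bullet> x + k) \<and> norm n = 1 \<and> (\<forall>x\<in>T. \<forall>y\<in>T. n \<bullet> (x - y) = 0) \<and>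
        w = a - (a \<bullet> n) *\<^sub>R n"
      using n w(1) by (intro exI[of _ w] exI[of _ "\<phi> x0 - w \<bullet> x0"] exI[of _ n]) auto
  next
    fix w' assume "\<exists>a k n. (\<forall>x\<in>T. \<phi> x = a \<bullet> x + k) \<and> norm n = 1 \<and> (\<forall>x\<in>T. \<forall>y\<in>T. n \<bullet> (x - y) = 0) \<and>
        w' = a - (a \<bullet> n) *\<^sub>R n"
    then obtain a k m where a: "\<forall>x\<in>T. \<phi> x = a \<bullet> x + k" "norm m = 1" "\<forall>x\<in>T. \<forall>y\<in>T. m \<bullet> (x - y) = 0"
      "w' = a - (a \<bullet> m) *\<^sub>R m" by blast
    have "w' \<bullet> m = 0" using a(2) by (simp add: a(4) inner_diff_left norm_eq_1)
    then have "w' \<bullet> n0 = 0" using perp[of m w'] a(2,3) by blast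
    moreover have "w \<bullet> n0 = 0" using perp[of n w] n w(1) by blast
    moreover have "w' - w = ((w' - w) \<bullet> n0) *\<^sub>R n0"
    proof (rule n0(3))
      fix x y assume xy: "x \<in> T" "y \<in> T"
      have "w' \<bullet> (x - y) = a \<bullet> (x - y)" using a(3) xy by (simp add: a(4) inner_diff_left)
      then show "(w' - w) \<bullet> (x - y) = 0"
        using w(2)[OF xy] a(1) xy by (simp add: inner_diff_left inner_diff_right)
    qed
    ultimately show "w' = w" by (simp add: inner_diff_left)
  qed
qed

lemma simplex_grad_characterization:
  fixes T :: "'a::euclidean_space set"
  assumes T: "int d simplex T" and dim: "DIM('a) = d + 1"
    and n: "norm n = 1" "\<And>x y. x \<in> T \<Longrightarrow> y \<in> T \<Longrightarrow> n \<bullet> (x - y) = 0"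
    and \<phi>: "\<exists>a k. \<forall>x\<in>T. \<phi> x = a \<bullet> x + k"
  shows "simplex_grad T \<phi> \<bullet> n = 0"
    and "\<And>x y. x \<in> T \<Longrightarrow> y \<in> T \<Longrightarrow> simplex_grad T \<phi> \<bullet> (x - y) = \<phi> x - \<phi> y"
proof -
  obtain a k where a: "\<forall>x\<in>T. \<phi> x = a \<bullet> x + k" using \<phi> by blast
  define w where "w = a - (a \<bullet> n) *\<^sub>R n"
  have 1: "w \<bullet> n = 0" using n(1) by (simp add: w_def inner_diff_left norm_eq_1)
  have 2: "w \<bullet> (x - y) = \<phi> x - \<phi> y" if "x \<in> T" "y \<in> T" for x y
    using a n(2)[OF that] that by (simp add: w_def inner_diff_left inner_diff_right)
  have "simplex_grad T \<phi> = w" by (rule simplex_grad_eqI[OF T dim n 1 2])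
  with 1 2 show "simplex_grad T \<phi> \<bullet> n = 0"
    "\<And>x y. x \<in> T \<Longrightarrow> y \<in> T \<Longrightarrow> simplex_grad T \<phi> \<bullet> (x - y) = \<phi> x - \<phi> y" by auto
qed

lemma simplex_grad_sum:
  fixes T :: "'a::euclidean_space set"
  assumes T: "int d simplex T" and dim: "DIM('a) = d + 1"
    and \<phi>: "\<And>i. i \<in> I \<Longrightarrow> \<exists>a k. \<forall>x\<in>T. \<phi> i x = a \<bullet> x + k"
  shows "simplex_grad T (\<lambda>x. \<Sum>i\<in>I. c i * \<phi> i x) = (\<Sum>i\<in>I. c i *\<^sub>R simplex_grad T (\<phi> i))"
proof -
  obtain n where n: "norm n = 1" "\<And>x y. x \<in> T \<Longrightarrow> y \<in> T \<Longrightarrow> n \<bullet> (x - y) = 0"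
    by (rule simplex_unit_normal[OF T dim]) (rule that)
  show ?thesis
  proof (rule simplex_grad_eqI[OF T dim n])
    show "(\<Sum>i\<in>I. c i *\<^sub>R simplex_grad T (\<phi> i)) \<bullet> n = 0"
      by (simp add: inner_sum_left simplex_grad_characterization(1)[OF T dim n \<phi>])
    fix x y assume xy: "x \<in> T" "y \<in> T"
    have "(\<Sum>i\<in>I. c i *\<^sub>R simplex_grad T (\<phi> i)) \<bullet> (x - y) = (\<Sum>i\<in>I. c i * (\<phi> i x - \<phi> i y))"
      unfolding inner_sum_left
      by (rule sum.cong) (simp_all add: simplex_grad_characterization(2)[OF T dim n \<phi> xy])
    then show "(\<Sum>i\<in>I. c i *\<^sub>R simplex_grad T (\<phi> i)) \<bullet> (x - y)
        = (\<Sum>i\<in>I. c i * \<phi> i x) - (\<Sum>i\<in>I. c i * \<phi> i y)"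
      by (simp add: right_diff_distrib sum_subtractf)
  qed
qed

lemma simplex_grad_const:
  fixes T :: "'a::euclidean_space set"
  assumes T: "int d simplex T" and dim: "DIM('a) = d + 1" and \<phi>: "\<And>x. x \<in> T \<Longrightarrow> \<phi> x = k"
  shows "simplex_grad T \<phi> = 0"
proof -
  obtain n where n: "norm n = 1" "\<And>x y. x \<in> T \<Longrightarrow> y \<in> T \<Longrightarrow> n \<bullet> (x - y) = 0"
    by (rule simplex_unit_normal[OF T dim]) (rule that)
  show ?thesis
  proof (rule simplex_grad_eqI[OF T dim n])
    show "0 \<bullet> n = 0" by simp
    show "0 \<bullet> (x - y) = \<phi> x - \<phi> y" if "x \<in> T" "y \<in> T" for x y
      using \<phi>[OF that(1)] \<phi>[OF that(2)] by simp
  qed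
qed

section \<open>Nodal functions on a simplicial mesh\<close>

lemma simplex_extreme_points:
  fixes T :: "'a::euclidean_space set"
  assumes "n simplex T"
  shows "\<not> affine_dependent {v. v extreme_point_of T}" "finite {v. v extreme_point_of T}"
    "convex hull {v. v extreme_point_of T} = T"
proof -
  obtain C where C: "\<not> affine_dependent C" "T = convex hull C"
    using assms by (auto simp: simplex_def)
  then have "{v. v extreme_point_of T} = C"
    by (simp add: extreme_point_of_convex_hull_affine_independent)
  then show "\<not> affine_dependent {v. v extreme_point_of T}" "finite {v. v extreme_point_of T}"
    "convex hull {v. v extreme_point_of T} = T"
    using C aff_independent_finite by auto
qed

lemma face_of_simplex_hull:
  fixes T :: "'a::euclidean_space set"
  assumes "n simplex T" "F face_of T"
  obtains C where "C \<subseteq> {v. v extreme_point_of T}" "F = convex hull C"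
  using face_of_convex_hull_affine_independent[OF simplex_extreme_points(1)[OF assms(1)], of F]
    simplex_extreme_points(3)[OF assms(1)] assms(2) by auto

locale simplicial_mesh =
  fixes \<T> :: "'a::euclidean_space set set" and d :: nat
  assumes dim: "DIM('a) = d + 1"
    and triangulation: "triangulation \<T>"
    and simplex: "T \<in> \<T> \<Longrightarrow> int d simplex T"
begin

lemma finite_mesh: "finite \<T>"
  using triangulation by (simp add: triangulation_def)

lemma face_Int: "T \<in> \<T> \<Longrightarrow> T' \<in> \<T> \<Longrightarrow> T \<inter> T' face_of T"
  using triangulation by (auto simp: triangulation_def)

lemma compact_elem: "T \<in> \<T> \<Longrightarrow> compact T" and convex_elem: "T \<in> \<T> \<Longrightarrow> convex T"
  using simplex compact_simplex convex_simplex by blast+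

lemma compact_mesh: "compact (\<Union>\<T>)"
  using finite_mesh compact_elem by blast

lemma nonempty_elem: "T \<in> \<T> \<Longrightarrow> T \<noteq> {}"
  using aff_dim_simplex[OF simplex] by force

lemma finite_mesh_vertices: "finite (mesh_vertices \<T>)"
proof -
  have "mesh_vertices \<T> = (\<Union>T\<in>\<T>. {v. v extreme_point_of T})" by (auto simp: mesh_vertices_def)
  then show ?thesis using finite_mesh simplex_extreme_points(2)[OF simplex] by simp
qed

text \<open>The simplices meet face to face, so a vertex of one simplex that lies in another is a vertex
  of the latter.\<close>

lemma mesh_vertex_in_elem_iff:
  assumes "T \<in> \<T>"
  shows "v \<in> mesh_vertices \<T> \<and> v \<in> T \<longleftrightarrow> v extreme_point_of T"
proof
  assume v: "v \<in> mesh_vertices \<T> \<and> v \<in> T"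
  then obtain T' where T': "T' \<in> \<T>" "v extreme_point_of T'" by (auto simp: mesh_vertices_def)
  then have "v \<in> T'" by (simp add: extreme_point_of_def)
  then have "v extreme_point_of (T' \<inter> T)"
    using extreme_point_of_face[OF face_Int[OF T'(1) assms], of v] T'(2) v by simp
  then show "v extreme_point_of T"
    using extreme_point_of_face[OF face_Int[OF assms T'(1)], of v] by (simp add: Int_commute)
qed (use assms in \<open>auto simp: mesh_vertices_def extreme_point_of_def\<close>)

lemma elem_eq_hull_vertices:
  assumes "T \<in> \<T>"
  shows "T = convex hull (mesh_vertices \<T> \<inter> T)"
proof -
  have "{v. v extreme_point_of T} = mesh_vertices \<T> \<inter> T"
    using mesh_vertex_in_elem_iff[OF assms] by blast
  then show ?thesis using simplex_extreme_points(3)[OF simplex[OF assms]] by simp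
qed

text \<open>Affine interpolants of nodal values on two simplices agree on the common face, because they
  agree at its vertices.\<close>

lemma nodal_function_exists:
  shows "\<exists>\<phi>. continuous_on (\<Union>\<T>) \<phi> \<and> (\<forall>T\<in>\<T>. \<exists>a k. \<forall>x\<in>T. \<phi> x = a \<bullet> x + k) \<and>
     (\<forall>B\<in>mesh_vertices \<T>. \<phi> B = c B) \<and> (\<forall>x. x \<notin> \<Union>\<T> \<longrightarrow> \<phi> x = (0::real))"
proof -
  have "\<forall>T\<in>\<T>. \<exists>a k. \<forall>v. v extreme_point_of T \<longrightarrow> a \<bullet> v + k = c v"
    using affine_interpolation_exists[OF simplex_extreme_points(1)[OF simplex]] by fastforce
  then obtain A K where AK: "\<And>T v. T \<in> \<T> \<Longrightarrow> v extreme_point_of T \<Longrightarrow> A T \<bullet> v + K T = c v"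
    by metis
  have agree: "A T \<bullet> x + K T = A T' \<bullet> x + K T'" if T: "T \<in> \<T>" "T' \<in> \<T>" and x: "x \<in> T" "x \<in> T'" for T T' x
  proof -
    obtain C where C: "C \<subseteq> {v. v extreme_point_of T}" "T \<inter> T' = convex hull C"
      using face_of_simplex_hull[OF simplex[OF T(1)] face_Int[OF T]] by metis
    show ?thesis
    proof (rule affine_eq_on_convex_hull)
      show "x \<in> convex hull C" using x C(2) by blast
      fix v assume v: "v \<in> C"
      then have "v extreme_point_of T" "v \<in> T'" using C hull_inc[of v C] by auto
      then have "v extreme_point_of T'"
        using mesh_vertex_in_elem_iff[OF T(1)] mesh_vertex_in_elem_iff[OF T(2)] by blast
      then show "A T \<bullet> v + K T = A T' \<bullet> v + K T'"
        using AK \<open>v extreme_point_of T\<close> T by simp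
    qed
  qed
  define \<phi> where "\<phi> x = (if x \<in> \<Union>\<T> then A (SOME T. T \<in> \<T> \<and> x \<in> T) \<bullet> x + K (SOME T. T \<in> \<T> \<and> x \<in> T) else 0)" for x
  have \<phi>: "\<phi> x = A T \<bullet> x + K T" if T: "T \<in> \<T>" "x \<in> T" for T x
  proof -
    define T' where "T' = (SOME T. T \<in> \<T> \<and> x \<in> T)"
    have "T' \<in> \<T> \<and> x \<in> T'"
      unfolding T'_def by (rule someI[of "\<lambda>T. T \<in> \<T> \<and> x \<in> T"]) (use T in blast)
    then have "A T' \<bullet> x + K T' = A T \<bullet> x + K T" by (intro agree T) auto
    moreover have "x \<in> \<Union>\<T>" using T by blast
    ultimately show ?thesis by (simp add: \<phi>_def T'_def)
  qed
  have "continuous_on (\<Union>T\<in>\<T>. T) \<phi>"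
  proof (rule continuous_on_closed_Union[OF finite_mesh])
    fix T assume T: "T \<in> \<T>"
    show "closed T" using compact_elem[OF T] compact_imp_closed by blast
    have "continuous_on T (\<lambda>x. A T \<bullet> x + K T)" by (intro continuous_intros)
    then show "continuous_on T \<phi>" using \<phi>[OF T] by (simp cong: continuous_on_cong)
  qed
  moreover have "\<phi> B = c B" if B: "B \<in> mesh_vertices \<T>" for B
  proof -
    obtain T where T: "T \<in> \<T>" "B extreme_point_of T" using B by (auto simp: mesh_vertices_def)
    then show ?thesis using AK[OF T] \<phi>[OF T(1), of B] by (simp add: extreme_point_of_def)
  qed
  moreover have "\<forall>T\<in>\<T>. \<exists>a k. \<forall>x\<in>T. \<phi> x = a \<bullet> x + k" using \<phi> by blast
  moreover have "\<forall>x. x \<notin> \<Union>\<T> \<longrightarrow> \<phi> x = 0" by (simp add: \<phi>_def)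
  ultimately show ?thesis by auto
qed

lemma nodal_function_unique:
  assumes T: "T \<in> \<T>" "x \<in> T"
    and "\<exists>a k. \<forall>x\<in>T. \<phi> x = a \<bullet> x + k" "\<exists>a k. \<forall>x\<in>T. \<psi> x = a \<bullet> x + k"
    and eq: "\<And>B. B \<in> mesh_vertices \<T> \<Longrightarrow> B \<in> T \<Longrightarrow> \<phi> B = (\<psi> B :: real)"
  shows "\<phi> x = \<psi> x"
proof -
  obtain a k a' k' where a: "\<forall>x\<in>T. \<phi> x = a \<bullet> x + k" "\<forall>x\<in>T. \<psi> x = a' \<bullet> x + k'"
    using assms by metis
  have "a \<bullet> x + k = a' \<bullet> x + k'"
  proof (rule affine_eq_on_convex_hull)
    show "x \<in> convex hull (mesh_vertices \<T> \<inter> T)" using T elem_eq_hull_vertices by blast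
    show "a \<bullet> v + k = a' \<bullet> v + k'" if "v \<in> mesh_vertices \<T> \<inter> T" for v
      using a eq[of v] that by auto
  qed
  then show ?thesis using a T by simp
qed

lemma
  shows continuous_on_hat: "continuous_on (\<Union>\<T>) (hat \<T> B)"
    and hat_affine: "T \<in> \<T> \<Longrightarrow> \<exists>a k. \<forall>x\<in>T. hat \<T> B x = a \<bullet> x + k"
    and hat_node: "B' \<in> mesh_vertices \<T> \<Longrightarrow> hat \<T> B B' = (if B' = B then 1 else 0)"
proof -
  let ?P = "\<lambda>\<phi>. continuous_on (\<Union>\<T>) \<phi> \<and>
     (\<forall>T\<in>\<T>. \<exists>a k. \<forall>x\<in>T. \<phi> x = a \<bullet> x + k) \<and>
     (\<forall>B'\<in>mesh_vertices \<T>. \<phi> B' = (if B' = B then 1 else 0)) \<and>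
     (\<forall>x. x \<notin> \<Union>\<T> \<longrightarrow> \<phi> x = (0::real))"
  obtain \<phi> where \<phi>: "?P \<phi>" using nodal_function_exists[of "\<lambda>B'. if B' = B then 1 else 0"] by blast
  have "\<psi> = \<phi>" if \<psi>: "?P \<psi>" for \<psi>
  proof
    fix x show "\<psi> x = \<phi> x"
    proof (cases "x \<in> \<Union>\<T>")
      case True
      then obtain T where T: "T \<in> \<T>" "x \<in> T" by blast
      show ?thesis by (rule nodal_function_unique[OF T]) (use \<phi> \<psi> T in auto)
    qed (use \<phi> \<psi> in simp)
  qed
  then have "?P (hat \<T> B)" unfolding hat_def using theI[of ?P, OF \<phi>] by blast
  then show "continuous_on (\<Union>\<T>) (hat \<T> B)" "T \<in> \<T> \<Longrightarrow> \<exists>a k. \<forall>x\<in>T. hat \<T> B x = a \<bullet> x + k"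
    "B' \<in> mesh_vertices \<T> \<Longrightarrow> hat \<T> B B' = (if B' = B then 1 else 0)" by blast+
qed

definition nodal_fun :: "('a \<Rightarrow> real) \<Rightarrow> 'a \<Rightarrow> real" where
  "nodal_fun c x = (\<Sum>B\<in>mesh_vertices \<T>. c B * hat \<T> B x)"

lemma nodal_fun_affine:
  assumes T: "T \<in> \<T>"
  shows "\<exists>a k. \<forall>x\<in>T. nodal_fun c x = a \<bullet> x + k"
proof -
  obtain A K where AK: "\<And>B x. x \<in> T \<Longrightarrow> hat \<T> B x = A B \<bullet> x + K B"
    using hat_affine[OF T] by metis
  have "nodal_fun c x = (\<Sum>B\<in>mesh_vertices \<T>. c B *\<^sub>R A B) \<bullet> x + (\<Sum>B\<in>mesh_vertices \<T>. c B * K B)"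
    if "x \<in> T" for x
    using that by (simp add: nodal_fun_def AK inner_sum_left sum.distrib distrib_left)
  then show ?thesis by blast
qed

lemma continuous_on_nodal_fun: "continuous_on (\<Union>\<T>) (nodal_fun c)"
  unfolding nodal_fun_def by (intro continuous_intros continuous_on_hat)

lemma nodal_fun_node: "B \<in> mesh_vertices \<T> \<Longrightarrow> nodal_fun c B = c B"
  unfolding nodal_fun_def by (simp add: hat_node finite_mesh_vertices if_distrib[of "\<lambda>t. _ * t"] cong: if_cong)

lemma nodal_fun_le_on_hull:
  assumes T: "T \<in> \<T>" and x: "x \<in> convex hull V" and V: "V \<subseteq> mesh_vertices \<T> \<inter> T"
    and le: "\<And>B. B \<in> V \<Longrightarrow> c B \<le> c' B"
  shows "nodal_fun c x \<le> nodal_fun c' x"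
proof -
  obtain a k a' k' where a: "\<forall>x\<in>T. nodal_fun c x = a \<bullet> x + k" "\<forall>x\<in>T. nodal_fun c' x = a' \<bullet> x + k'"
    using nodal_fun_affine[OF T] by metis
  have "0 \<le> (a' - a) \<bullet> x + (k' - k)"
  proof (rule affine_nonneg_on_convex_hull[OF _ x])
    fix v assume v: "v \<in> V"
    then have "nodal_fun c v = c v" "nodal_fun c' v = c' v" using V by (auto intro!: nodal_fun_node)
    then show "0 \<le> (a' - a) \<bullet> v + (k' - k)"
      using a le[OF v] v V by (force simp: inner_diff_left)
  qed
  moreover have "x \<in> T"
    using x V convex_elem[OF T] by (meson hull_minimal inf.boundedE subsetD)
  ultimately show ?thesis using a by (simp add: inner_diff_left)
qed

lemma nodal_fun_mono:
  assumes x: "x \<in> \<Union>\<T>" and le: "\<And>B. B \<in> mesh_vertices \<T> \<Longrightarrow> c B \<le> c' B"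
  shows "nodal_fun c x \<le> nodal_fun c' x"
proof -
  obtain T where T: "T \<in> \<T>" "x \<in> T" using x by blast
  then have "x \<in> convex hull (mesh_vertices \<T> \<inter> T)" using elem_eq_hull_vertices by blast
  then show ?thesis using nodal_fun_le_on_hull[OF T(1)] le by blast
qed

lemma nodal_fun_const:
  assumes "x \<in> \<Union>\<T>"
  shows "nodal_fun (\<lambda>_. k) x = k"
proof -
  obtain T where T: "T \<in> \<T>" "x \<in> T" using assms by blast
  have "\<exists>a l. \<forall>x\<in>T. k = a \<bullet> x + l" by (rule exI[of _ 0]) auto
  then show ?thesis
    using nodal_function_unique[OF T nodal_fun_affine[OF T(1)], of "\<lambda>_. k" "\<lambda>_. k"] by (simp add: nodal_fun_node)
qed

text \<open>A boundary facet is the hull of vertices, and these belong to the facet, hence to the boundary.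
  Inequalities between nodal functions therefore only have to be checked at boundary vertices.\<close>

lemma mesh_boundary_hull:
  assumes "x \<in> mesh_boundary \<T>"
  obtains T V where "T \<in> \<T>" "V \<subseteq> mesh_vertices \<T> \<inter> T" "V \<subseteq> boundary_vertices \<T>" "x \<in> convex hull V"
proof -
  obtain F where F': "x \<in> F" "F \<in> {F. \<exists>!T. T \<in> \<T> \<and> F facet_of T}"
    using assms unfolding mesh_boundary_def by (rule UnionE)
  then have sub: "F \<subseteq> mesh_boundary \<T>" unfolding mesh_boundary_def by (intro Union_upper)
  have "\<exists>T. T \<in> \<T> \<and> F facet_of T" using F'(2) by (intro ex1_implies_ex) simp
  then obtain T where F: "x \<in> F" "T \<in> \<T>" "F facet_of T" using F'(1) by blast
  obtain C where C: "C \<subseteq> {v. v extreme_point_of T}" "F = convex hull C"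
    using face_of_simplex_hull[OF simplex[OF F(2)] facet_of_imp_face_of[OF F(3)]] by metis
  show thesis
  proof (rule that)
    show CT: "C \<subseteq> mesh_vertices \<T> \<inter> T" using C(1) mesh_vertex_in_elem_iff[OF F(2)] by blast
    show "C \<subseteq> boundary_vertices \<T>"
      unfolding boundary_vertices_def using CT sub hull_subset[of C convex] C(2) by blast
  qed (use F C in auto)
qed

lemma nodal_fun_mono_boundary:
  assumes x: "x \<in> mesh_boundary \<T>" and le: "\<And>B. B \<in> boundary_vertices \<T> \<Longrightarrow> c B \<le> c' B"
  shows "nodal_fun c x \<le> nodal_fun c' x"
  by (rule mesh_boundary_hull[OF x]) (blast intro: nodal_fun_le_on_hull le)

lemma mesh_boundary_subset: "mesh_boundary \<T> \<subseteq> \<Union>\<T>"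
  unfolding mesh_boundary_def using facet_of_imp_subset by blast

lemma hat_pos_rel_interior:
  assumes T: "T \<in> \<T>" and B: "B \<in> mesh_vertices \<T>" "B \<in> T" and x: "x \<in> rel_interior T"
  shows "0 < hat \<T> B x"
proof -
  obtain a k where a: "\<forall>x\<in>T. hat \<T> B x = a \<bullet> x + k" using hat_affine[OF T] by blast
  have "0 < a \<bullet> x + k"
  proof (rule affine_pos_on_rel_interior[OF convex_elem[OF T] _ B(2) _ x])
    show "0 < a \<bullet> B + k" using a B hat_node[OF B(1), of B] by simp
    fix y assume y: "y \<in> T"
    show "0 \<le> a \<bullet> y + k"
    proof (rule affine_nonneg_on_convex_hull)
      show "y \<in> convex hull (mesh_vertices \<T> \<inter> T)" using y elem_eq_hull_vertices[OF T] by blast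
      fix v assume "v \<in> mesh_vertices \<T> \<inter> T"
      then show "0 \<le> a \<bullet> v + k" using a hat_node[of v B] by (metis IntE order_refl zero_le_one)
    qed
  qed
  then show ?thesis using a x rel_interior_subset by (metis subsetD)
qed

lemma hat_zero:
  assumes T: "T \<in> \<T>" and B: "B \<in> mesh_vertices \<T>" "B \<notin> T" and x: "x \<in> T"
  shows "hat \<T> B x = 0"
proof (rule nodal_function_unique[OF T x hat_affine[OF T]])
  show "\<exists>a k. \<forall>x\<in>T. 0 = a \<bullet> x + k" by (rule exI[of _ 0]) auto
  show "hat \<T> B B' = 0" if "B' \<in> mesh_vertices \<T>" "B' \<in> T" for B'
    using that B hat_node by auto
qed

lemma rel_interior_unique:
  assumes "T \<in> \<T>" "T' \<in> \<T>" "x \<in> rel_interior T" "x \<in> rel_interior T'"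
  shows "T' = T"
proof -
  have x: "x \<in> T" "x \<in> T'" using assms rel_interior_subset by blast+
  have "T \<subseteq> T' \<inter> T"
    using subset_of_face_of[OF face_Int[OF assms(1,2)], of T] assms x by (simp add: Int_commute) blast
  moreover have "T' \<subseteq> T \<inter> T'"
    using subset_of_face_of[OF face_Int[OF assms(2,1)], of T'] assms x by (simp add: Int_commute) blast
  ultimately show ?thesis by blast
qed

lemma mesh_grad_rel_interior:
  assumes T: "T \<in> \<T>" and x: "x \<in> rel_interior T"
  shows "mesh_grad \<T> \<phi> x = simplex_grad T \<phi>"
proof -
  have "(THE T. T \<in> \<T> \<and> x \<in> rel_interior T) = T"
    using T x rel_interior_unique by (intro the_equality) auto
  then show ?thesis using T x unfolding mesh_grad_def by auto
qed

text \<open>Write \<open>c = k + v - w\<close> with the positive part \<open>v\<close> and the negative part \<open>w\<close> of \<open>c - k\<close>. The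
  constant has gradient zero, and in the cross term \<open>w B * v B'\<close> vanishes for \<open>B = B'\<close>, so that only
  the non-positive products of the gradients of different basis functions occur.\<close>

lemma grad_positive_part_le:
  assumes T: "T \<in> \<T>"
    and bdry: "\<And>B. B \<in> boundary_vertices \<T> \<Longrightarrow> c B \<le> k"
    and acute: "\<And>B B'. B \<in> inner_vertices \<T> \<Longrightarrow> B' \<in> mesh_vertices \<T> \<Longrightarrow> B \<noteq> B' \<Longrightarrow> B \<in> T \<Longrightarrow> B' \<in> T \<Longrightarrow>
        simplex_grad T (hat \<T> B) \<bullet> simplex_grad T (hat \<T> B') \<le> 0"
  defines "v \<equiv> \<lambda>B. max (c B - k) 0"
  shows "(norm (simplex_grad T (nodal_fun v)))\<^sup>2 \<le> simplex_grad T (nodal_fun c) \<bullet> simplex_grad T (nodal_fun v)"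
proof -
  define w where "w B = max (k - c B) 0" for B
  define G where "G B = simplex_grad T (hat \<T> B)" for B
  let ?M = "mesh_vertices \<T>"
  have grad: "simplex_grad T (nodal_fun c) = (\<Sum>B\<in>?M. c B *\<^sub>R G B)" for c
    unfolding nodal_fun_def G_def by (rule simplex_grad_sum[OF simplex[OF T] dim hat_affine[OF T]])
  have "simplex_grad T (nodal_fun (\<lambda>_. k)) = 0"
    by (rule simplex_grad_const[OF simplex[OF T] dim]) (use T nodal_fun_const in blast)
  then have "(\<Sum>B\<in>?M. k *\<^sub>R G B) = 0" by (simp add: grad)
  moreover have "(\<Sum>B\<in>?M. c B *\<^sub>R G B) = (\<Sum>B\<in>?M. k *\<^sub>R G B) + (\<Sum>B\<in>?M. v B *\<^sub>R G B) - (\<Sum>B\<in>?M. w B *\<^sub>R G B)"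
    unfolding sum.distrib[symmetric] sum_subtractf[symmetric]
    by (rule sum.cong) (auto simp: v_def w_def scaleR_add_left[symmetric] scaleR_diff_left[symmetric] max_def)
  moreover have "(\<Sum>B\<in>?M. w B *\<^sub>R G B) \<bullet> (\<Sum>B\<in>?M. v B *\<^sub>R G B) \<le> 0"
    unfolding inner_sum_left inner_sum_right
  proof (intro sum_nonpos)
    fix B' B assume B: "B' \<in> ?M" "B \<in> ?M"
    have "w B' * v B * (G B' \<bullet> G B) \<le> 0"
    proof (cases "c B > k \<and> B \<noteq> B' \<and> B \<in> T \<and> B' \<in> T")
      case True
      then have "B \<in> inner_vertices \<T>"
        using bdry B unfolding inner_vertices_def boundary_vertices_def by force
      then have "G B' \<bullet> G B \<le> 0" using acute[of B B'] True B by (simp add: G_def inner_commute)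
      moreover have "0 \<le> w B' * v B" by (simp add: w_def v_def)
      ultimately show ?thesis by (simp add: mult_nonneg_nonpos)
    next
      case False
      have "G B = 0" if "B \<notin> T" "B \<in> ?M" for B
        unfolding G_def by (rule simplex_grad_const[OF simplex[OF T] dim hat_zero[OF T that(2,1)]])
      then show ?thesis using False B by (auto simp: v_def w_def)
    qed
    then show "w B' *\<^sub>R G B' \<bullet> v B *\<^sub>R G B \<le> 0" by (simp add: mult_ac)
  qed
  ultimately show ?thesis
    by (simp add: grad inner_diff_left power2_norm_eq_inner)
qed

end

section \<open>Flatness of a smooth compact hypersurface\<close>

lemma onorm_le_sum_Basis:
  fixes L :: "'a::euclidean_space \<Rightarrow> 'b::real_normed_vector"
  assumes L: "linear L" and B: "\<And>e. e \<in> Basis \<Longrightarrow> norm (L e) \<le> B"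
  shows "onorm L \<le> real DIM('a) * B"
proof (rule onorm_le)
  fix x :: 'a
  have "L x = L (\<Sum>e\<in>Basis. (x \<bullet> e) *\<^sub>R e)" by (simp add: euclidean_representation)
  also have "\<dots> = (\<Sum>e\<in>Basis. (x \<bullet> e) *\<^sub>R L e)"
    by (simp add: linear_sum[OF L] linear_cmul[OF L])
  finally have "norm (L x) \<le> (\<Sum>e\<in>Basis. norm ((x \<bullet> e) *\<^sub>R L e))"
    by (metis norm_sum)
  also have "\<dots> \<le> (\<Sum>e\<in>(Basis::'a set). norm x * B)"
    by (rule sum_mono) (auto intro!: mult_mono B Basis_le_norm)
  finally show "norm (L x) \<le> real DIM('a) * B * norm x" by (simp add: mult_ac)
qed

text \<open>The linearization error between two points near \<open>p\<close> is controlled with the single derivative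
  at \<open>p\<close>, because the derivative is continuous there.\<close>

lemma C1_strictly_differentiable:
  fixes f :: "'a::euclidean_space \<Rightarrow> 'b::real_normed_vector"
  assumes U: "open U" "p \<in> U" and f: "Ck_on (Suc 0) f U" and \<eta>: "0 < \<eta>"
  obtains r where "0 < r" "ball p r \<subseteq> U"
    "\<And>x y. x \<in> ball p r \<Longrightarrow> y \<in> ball p r \<Longrightarrow>
      norm (f y - f x - frechet_derivative f (at p) (y - x)) \<le> \<eta> * norm (y - x)"
proof -
  define D where "D x = frechet_derivative f (at x)" for x
  define m where "m = \<eta> / real DIM('a)"
  have m: "0 < m" using \<eta> by (simp add: m_def)
  have D: "(f has_derivative D x) (at x)" if "x \<in> U" for x
    using f that frechet_derivative_works by (auto simp: D_def)
  have lin: "linear (D x)" if "x \<in> U" for x using D[OF that] has_derivative_linear by blast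
  have "\<exists>r>0. \<forall>x\<in>U. dist x p < r \<longrightarrow> dist (D x e) (D p e) < m" for e
  proof -
    have "continuous_on U (\<lambda>x. D x e)" using f by (simp add: D_def)
    then show ?thesis using U(2) m unfolding continuous_on_iff by blast
  qed
  then obtain R where R: "\<And>e. 0 < R e" "\<And>e x. x \<in> U \<Longrightarrow> dist x p < R e \<Longrightarrow> dist (D x e) (D p e) < m"
    by metis
  obtain s where s: "0 < s" "ball p s \<subseteq> U" using U open_contains_ball by blast
  define r where "r = min s (Min (R ` Basis))"
  have r: "0 < r" using s R(1) by (simp add: r_def)
  have rU: "ball p r \<subseteq> U" using s by (auto simp: r_def)
  have rR: "r \<le> R e" if "e \<in> Basis" for e
    unfolding r_def using that by (intro min.coboundedI2 Min_le) auto
  have on: "onorm (D x - D p) \<le> \<eta>" if x: "x \<in> ball p r" for x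
  proof -
    have xU: "x \<in> U" using x rU by blast
    have "onorm (D x - D p) \<le> real DIM('a) * m"
    proof (rule onorm_le_sum_Basis)
      show "linear (D x - D p)"
        using linear_compose_sub[OF lin[OF xU] lin[OF U(2)]] by (simp add: fun_diff_def)
      fix e :: 'a assume e: "e \<in> Basis"
      have "dist x p < R e" using x rR[OF e] by (simp add: dist_commute)
      then show "norm ((D x - D p) e) \<le> m" using R(2)[OF xU] by (simp add: dist_norm less_imp_le)
    qed
    then show ?thesis by (simp add: m_def)
  qed
  have "norm (f y - f x - D p (y - x)) \<le> norm (y - x) * \<eta>" if xy: "x \<in> ball p r" "y \<in> ball p r" for x y
  proof (rule differentiable_bound_linearization)
    show "x + t *\<^sub>R (y - x) \<in> ball p r" if t: "t \<in> {0..1}" for t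
    proof -
      have "(1 - t) *\<^sub>R x + t *\<^sub>R y \<in> ball p r"
        using convex_ball[of p r] xy t unfolding convex_alt by auto
      then show ?thesis by (simp add: algebra_simps)
    qed
    show "(f has_derivative D z) (at z within ball p r)" if "z \<in> ball p r" for z
      using D rU that has_derivative_at_withinI by blast
    show "p \<in> ball p r" using r by simp
  qed (rule on)
  then show thesis using that[OF r rU] by (simp add: D_def mult.commute)
qed

lemma smooth_on_C1: "smooth_on U f \<Longrightarrow> Ck_on (Suc 0) f U"
  unfolding smooth_on_def by blast

text \<open>In a slice chart, the half-line in the direction of \<open>w\<close> pulls back to a curve in \<open>S\<close> with
  velocity \<open>w\<close>, up to a positive factor.\<close>

lemma tangent_spaceI_chart:
  fixes S :: "'a::euclidean_space set"
  assumes ch: "smooth_chart W \<phi>" and p: "p \<in> W"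
    and C: "\<phi> ` (S \<inter> W) = \<phi> ` W \<inter> C"
    and w: "\<And>t. 0 \<le> t \<Longrightarrow> \<phi> p + t *\<^sub>R frechet_derivative \<phi> (at p) w \<in> C"
  shows "w \<in> tangent_space S p"
proof -
  obtain \<psi> where W: "open W" "open (\<phi> ` W)" and sm: "smooth_on W \<phi>" "smooth_on (\<phi> ` W) \<psi>"
    and inv: "\<And>x. x \<in> W \<Longrightarrow> \<psi> (\<phi> x) = x"
    using ch unfolding smooth_chart_def by metis
  define z where "z = frechet_derivative \<phi> (at p) w"
  define E where "E = frechet_derivative \<psi> (at (\<phi> p))"
  have D\<phi>: "(\<phi> has_derivative frechet_derivative \<phi> (at p)) (at p)"
    using smooth_on_C1[OF sm(1)] p by (simp add: frechet_derivative_works[symmetric])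
  have D\<psi>: "(\<psi> has_derivative E) (at (\<phi> p))"
    using smooth_on_C1[OF sm(2)] p by (simp add: E_def frechet_derivative_works[symmetric])
  have "((\<psi> \<circ> \<phi>) has_derivative E \<circ> frechet_derivative \<phi> (at p)) (at p)"
    by (rule diff_chain_at[OF D\<phi> D\<psi>])
  moreover have "((\<psi> \<circ> \<phi>) has_derivative (\<lambda>h. h)) (at p)"
    by (rule has_derivative_transform_within_open[OF has_derivative_ident W(1) p]) (simp add: inv)
  ultimately have "E \<circ> frechet_derivative \<phi> (at p) = (\<lambda>h. h)"
    by (rule has_derivative_unique)
  then have Ez: "E z = w" unfolding z_def by (metis comp_apply)
  have linE: "linear E" using D\<psi> has_derivative_linear by blast
  obtain r where r: "0 < r" "ball (\<phi> p) r \<subseteq> \<phi> ` W" using W(2) p open_contains_ball by (metis imageI)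
  \<comment> \<open>The factor slows the curve down, so that it stays in the chart for all times in \<open>{0..1}\<close>.\<close>
  define \<kappa> where "\<kappa> = r / (norm z + 1)"
  have \<kappa>: "0 < \<kappa>" using r by (simp add: \<kappa>_def add_nonneg_pos)
  have "0 < norm z + 1" by (rule add_nonneg_pos) simp_all
  then have "\<kappa> * (norm z + 1) = r" by (simp add: \<kappa>_def)
  then have \<kappa>z: "\<kappa> * norm z < r" using \<kappa> by (simp add: distrib_left)
  define c where "c t = \<psi> (\<phi> p + t *\<^sub>R (\<kappa> *\<^sub>R z))" for t :: real
  have "c 0 = p" using inv[OF p] by (simp add: c_def)
  moreover have "c t \<in> S" if t: "t \<in> {0..1}" for t
  proof -
    have "t * (\<kappa> * norm z) \<le> 1 * (\<kappa> * norm z)" using t \<kappa> by (intro mult_right_mono) auto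
    then have "t * (\<kappa> * norm z) < r" using \<kappa>z by linarith
    then have "\<phi> p + t *\<^sub>R (\<kappa> *\<^sub>R z) \<in> ball (\<phi> p) r"
      using \<kappa> t by (simp add: dist_norm mult.assoc)
    moreover have "\<phi> p + t *\<^sub>R (\<kappa> *\<^sub>R z) \<in> C"
      using w[of "t * \<kappa>"] t \<kappa> by (simp add: z_def)
    ultimately have "\<phi> p + t *\<^sub>R (\<kappa> *\<^sub>R z) \<in> \<phi> ` (S \<inter> W)" using r(2) C by blast
    then obtain y where "y \<in> S" "y \<in> W" "\<phi> p + t *\<^sub>R (\<kappa> *\<^sub>R z) = \<phi> y" by blast
    then show ?thesis using inv by (simp add: c_def)
  qed
  moreover have "(c has_vector_derivative \<kappa> *\<^sub>R w) (at 0 within {0..1})"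
  proof -
    have 1: "((\<lambda>t. \<phi> p + t *\<^sub>R (\<kappa> *\<^sub>R z)) has_vector_derivative \<kappa> *\<^sub>R z) (at 0)"
      by (auto intro!: derivative_eq_intros)
    have "(\<psi> \<circ> (\<lambda>t. \<phi> p + t *\<^sub>R (\<kappa> *\<^sub>R z)) has_derivative E \<circ> (\<lambda>t. t *\<^sub>R (\<kappa> *\<^sub>R z))) (at 0)"
      by (rule diff_chain_at) (use 1 D\<psi> in \<open>simp_all add: has_vector_derivative_def\<close>)
    then have "(c has_vector_derivative \<kappa> *\<^sub>R w) (at 0)"
      unfolding has_vector_derivative_def c_def comp_def
      by (simp add: linear_cmul[OF linE] Ez)
    then show ?thesis by (rule has_vector_derivative_at_within)
  qed
  ultimately have "\<kappa> *\<^sub>R w \<in> tangent_space S p"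
    unfolding tangent_space_def by (intro span_base) blast
  then have "(1 / \<kappa>) *\<^sub>R (\<kappa> *\<^sub>R w) \<in> tangent_space S p"
    unfolding tangent_space_def by (rule span_mul)
  then show ?thesis using \<kappa> by simp
qed

text \<open>At a boundary point only the vectors pointing to the half-space are velocities of curves in
  \<open>S\<close>, but \<open>w\<close> or \<open>- w\<close> is one of them.\<close>

lemma slice_chart_tangent:
  fixes S :: "'a::euclidean_space set"
  assumes S: "smooth_hypersurface S" and p: "p \<in> S"
  obtains W \<phi> e where "smooth_chart W \<phi>" "p \<in> W" "norm e = 1" "\<And>x. x \<in> S \<inter> W \<Longrightarrow> \<phi> x \<bullet> e = 0"
    "\<And>w. frechet_derivative \<phi> (at p) w \<bullet> e = 0 \<Longrightarrow> w \<in> tangent_space S p"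
proof -
  consider "interior_slice_point S p" | "boundary_slice_point S p"
    using S p unfolding smooth_hypersurface_def by blast
  then show thesis
  proof cases
    case 1
    then obtain W \<phi> e where e: "e \<in> Basis" and ch: "smooth_chart W \<phi>" "p \<in> W"
      and C: "\<phi> ` (S \<inter> W) = \<phi> ` W \<inter> {y. y \<bullet> e = 0}"
      unfolding interior_slice_point_def by blast
    have z: "\<phi> x \<bullet> e = 0" if "x \<in> S \<inter> W" for x using C that by blast
    show thesis
    proof (rule that[OF ch _ z])
      show "norm e = 1" using e by simp
      show "w \<in> tangent_space S p" if "frechet_derivative \<phi> (at p) w \<bullet> e = 0" for w
        by (rule tangent_spaceI_chart[OF ch C]) (use that z[of p] p ch(2) in \<open>simp add: inner_add_left\<close>)
    qed
  next
    case 2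
    then obtain W \<phi> e e' where e: "e \<in> Basis" and ch: "smooth_chart W \<phi>" "p \<in> W"
      and C: "\<phi> ` (S \<inter> W) = \<phi> ` W \<inter> {y. y \<bullet> e = 0 \<and> 0 \<le> y \<bullet> e'}" and pe': "\<phi> p \<bullet> e' = 0"
      unfolding boundary_slice_point_def by blast
    have z: "\<phi> x \<bullet> e = 0" if "x \<in> S \<inter> W" for x using C that by blast
    have sm: "smooth_on W \<phi>" using ch(1) unfolding smooth_chart_def by blast
    have lin: "linear (frechet_derivative \<phi> (at p))"
      by (rule linear_frechet_derivative) (use smooth_on_C1[OF sm] ch(2) in simp)
    have pos: "w \<in> tangent_space S p"
      if "frechet_derivative \<phi> (at p) w \<bullet> e = 0" "0 \<le> frechet_derivative \<phi> (at p) w \<bullet> e'" for w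
      by (rule tangent_spaceI_chart[OF ch C]) (use that z[of p] p ch(2) pe' in \<open>simp add: inner_add_left\<close>)
    show thesis
    proof (rule that[OF ch _ z])
      show "norm e = 1" using e by simp
      fix w assume w: "frechet_derivative \<phi> (at p) w \<bullet> e = 0"
      show "w \<in> tangent_space S p"
      proof (cases "0 \<le> frechet_derivative \<phi> (at p) w \<bullet> e'")
        case False
        then have "- w \<in> tangent_space S p" using w by (intro pos) (auto simp: linear_neg[OF lin])
        then have "- (- w) \<in> tangent_space S p" unfolding tangent_space_def by (rule span_neg)
        then show ?thesis by simp
      qed (use pos w in blast)
    qed
  qed
qed

lemma linear_functional_ker_subset:
  fixes f g :: "'a::real_vector \<Rightarrow> real"
  assumes f: "linear f" and g: "linear g" and ker: "\<And>w. f w = 0 \<Longrightarrow> g w = 0"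
  obtains c where "\<And>w. g w = c * f w"
proof (cases "\<forall>w. f w = 0")
  case True
  then show thesis using that[of 0] ker by simp
next
  case False
  then obtain w0 where w0: "f w0 \<noteq> 0" by blast
  have "g w = g w0 / f w0 * f w" for w
  proof -
    have "f (w - (f w / f w0) *\<^sub>R w0) = 0"
      using w0 by (simp add: linear_diff[OF f] linear_cmul[OF f])
    then have "g (w - (f w / f w0) *\<^sub>R w0) = 0" by (rule ker)
    then show ?thesis by (simp add: linear_diff[OF g] linear_cmul[OF g])
  qed
  then show thesis by (rule that)
qed

text \<open>A finite subcover yields a common \<open>L\<close>, and a Lebesgue number of it yields \<open>\<rho>\<close>.\<close>

lemma compact_local_bound_uniform:
  fixes S :: "'a::metric_space set"
  assumes S: "compact S"
    and loc: "\<And>p. p \<in> S \<Longrightarrow> \<exists>r>0. \<exists>L::real. \<forall>x\<in>S \<inter> ball p r. \<forall>y\<in>S \<inter> ball p r. P x y L"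
    and mono: "\<And>x y L L'. P x y L \<Longrightarrow> L \<le> L' \<Longrightarrow> P x y L'"
  obtains \<rho> L where "0 < \<rho>" "\<And>x y. x \<in> S \<Longrightarrow> y \<in> S \<Longrightarrow> dist x y < \<rho> \<Longrightarrow> P x y L"
proof -
  obtain r L where r: "\<And>p. p \<in> S \<Longrightarrow> 0 < r p"
    and L: "\<And>p x y. p \<in> S \<Longrightarrow> x \<in> S \<inter> ball p (r p) \<Longrightarrow> y \<in> S \<inter> ball p (r p) \<Longrightarrow> P x y (L p)"
    using loc by metis
  have "S \<subseteq> (\<Union>p\<in>S. ball p (r p))" using r by force
  then obtain C where C: "C \<subseteq> S" "finite C" "S \<subseteq> (\<Union>p\<in>C. ball p (r p))"
    by (rule compactE_image[OF S, rotated]) auto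
  obtain \<rho> where \<rho>: "0 < \<rho>" "\<And>x. x \<in> S \<Longrightarrow> \<exists>G\<in>(\<lambda>p. ball p (r p)) ` C. ball x \<rho> \<subseteq> G"
  proof (rule Heine_Borel_lemma[OF S])
    show "S \<subseteq> \<Union>((\<lambda>p. ball p (r p)) ` C)" by (rule C(3))
    show "open G" if "G \<in> (\<lambda>p. ball p (r p)) ` C" for G using that by auto
  qed (rule that)
  show thesis
  proof (rule that[OF \<rho>(1)])
    fix x y assume x: "x \<in> S" and y: "y \<in> S" and d: "dist x y < \<rho>"
    obtain p where p: "p \<in> C" "ball x \<rho> \<subseteq> ball p (r p)" using \<rho>(2)[OF x] by blast
    have "x \<in> ball x \<rho>" "y \<in> ball x \<rho>" using d \<rho>(1) by auto
    then have "x \<in> ball p (r p)" "y \<in> ball p (r p)" using p(2) by blast+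
    then have "P x y (L p)" using L x y p(1) C(1) by blast
    then show "P x y (Max (L ` C))" by (rule mono) (use p(1) C(2) in simp)
  qed
qed

lemma unit_normal_continuous_on:
  assumes "unit_normal S \<nu>"
  shows "continuous_on S \<nu>"
proof -
  obtain U N where N: "S \<subseteq> U" "smooth_on U N" "\<And>x. x \<in> S \<Longrightarrow> \<nu> x = N x"
    using assms unfolding unit_normal_def by blast
  have "continuous_on U N" using N(2) unfolding smooth_on_def by (metis Ck_on.simps(1))
  then have "continuous_on S N" using N(1) continuous_on_subset by blast
  then show ?thesis using N(3) by (simp cong: continuous_on_cong)
qed

lemma unit_normal_Lipschitz:
  fixes S :: "'a::euclidean_space set"
  assumes S: "compact S" and \<nu>: "unit_normal S \<nu>"
  obtains \<rho> L where "0 < \<rho>" "0 \<le> L"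
    "\<And>P Q. P \<in> S \<Longrightarrow> Q \<in> S \<Longrightarrow> dist P Q < \<rho> \<Longrightarrow> norm (\<nu> P - \<nu> Q) \<le> L * norm (P - Q)"
proof -
  obtain U N where N: "open U" "S \<subseteq> U" "smooth_on U N" "\<And>x. x \<in> S \<Longrightarrow> \<nu> x = N x"
    using \<nu> unfolding unit_normal_def by blast
  have "\<exists>\<rho>>0. \<exists>L. \<forall>P Q. P \<in> S \<longrightarrow> Q \<in> S \<longrightarrow> dist P Q < \<rho> \<longrightarrow> norm (\<nu> P - \<nu> Q) \<le> L * norm (P - Q)"
  proof (rule compact_local_bound_uniform[OF S, of "\<lambda>P Q L. norm (\<nu> P - \<nu> Q) \<le> L * norm (P - Q)"])
    fix p assume p: "p \<in> S"
    then have pU: "p \<in> U" using N(2) by blast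
    obtain r where r: "0 < r" "ball p r \<subseteq> U" "\<And>x y. x \<in> ball p r \<Longrightarrow> y \<in> ball p r \<Longrightarrow>
      norm (N y - N x - frechet_derivative N (at p) (y - x)) \<le> 1 * norm (y - x)"
      using C1_strictly_differentiable[OF N(1) pU smooth_on_C1[OF N(3)] zero_less_one] by metis
    let ?D = "frechet_derivative N (at p)"
    have "bounded_linear ?D"
      using smooth_on_C1[OF N(3)] pU frechet_derivative_works has_derivative_bounded_linear by fastforce
    have "norm (\<nu> y - \<nu> x) \<le> (onorm ?D + 1) * norm (y - x)" if "x \<in> S \<inter> ball p r" "y \<in> S \<inter> ball p r" for x y
    proof -
      have "norm (N y - N x) \<le> norm (N y - N x - ?D (y - x)) + norm (?D (y - x))"
        by (metis norm_triangle_sub add.commute)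
      also have "\<dots> \<le> 1 * norm (y - x) + onorm ?D * norm (y - x)"
        using r(3)[of x y] that onorm[OF \<open>bounded_linear ?D\<close>, of "y - x"] by (intro add_mono) auto
      finally show ?thesis using N(4) that by (simp add: algebra_simps)
    qed
    then show "\<exists>r>0. \<exists>L. \<forall>x\<in>S \<inter> ball p r. \<forall>y\<in>S \<inter> ball p r. norm (\<nu> x - \<nu> y) \<le> L * norm (x - y)"
      using r(1) by blast
  next
    fix x y and L L' :: real assume "norm (\<nu> x - \<nu> y) \<le> L * norm (x - y)" "L \<le> L'"
    moreover from \<open>L \<le> L'\<close> have "L * norm (x - y) \<le> L' * norm (x - y)" by (intro mult_right_mono) auto
    ultimately show "norm (\<nu> x - \<nu> y) \<le> L' * norm (x - y)" by linarith
  qed blast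
  then obtain \<rho> L where *: "0 < \<rho>" "\<And>P Q. P \<in> S \<Longrightarrow> Q \<in> S \<Longrightarrow> dist P Q < \<rho> \<Longrightarrow> norm (\<nu> P - \<nu> Q) \<le> L * norm (P - Q)"
    by blast
  show thesis
  proof (rule that[OF *(1), of "max L 0"])
    fix P Q assume "P \<in> S" "Q \<in> S" "dist P Q < \<rho>"
    then have "norm (\<nu> P - \<nu> Q) \<le> L * norm (P - Q)" by (rule *(2))
    also have "\<dots> \<le> max L 0 * norm (P - Q)" by (intro mult_right_mono) auto
    finally show "norm (\<nu> P - \<nu> Q) \<le> max L 0 * norm (P - Q)" .
  qed simp
qed

text \<open>Secants of \<open>S\<close> are nearly tangential, uniformly on the compact \<open>S\<close>: a slice chart straightens
  \<open>S\<close>, so the secant is nearly in the kernel of the derivative of the straightened coordinate, which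
  is proportional to the normal component.\<close>

lemma unit_normal_secant:
  fixes S :: "'a::euclidean_space set"
  assumes S: "compact S" "smooth_hypersurface S" and \<nu>: "unit_normal S \<nu>" and \<eta>: "0 < \<eta>"
  obtains \<rho> where "0 < \<rho>"
    "\<And>P Q. P \<in> S \<Longrightarrow> Q \<in> S \<Longrightarrow> dist P Q < \<rho> \<Longrightarrow> \<bar>\<nu> P \<bullet> (Q - P)\<bar> \<le> \<eta> * norm (Q - P)"
proof -
  have "\<exists>\<rho>>0. \<forall>P Q. P \<in> S \<longrightarrow> Q \<in> S \<longrightarrow> dist P Q < \<rho> \<longrightarrow> \<bar>\<nu> P \<bullet> (Q - P)\<bar> \<le> \<eta> * norm (Q - P)"
  proof (rule compact_local_bound_uniform[OF S(1), of "\<lambda>P Q L. \<bar>\<nu> P \<bullet> (Q - P)\<bar> \<le> \<eta> * norm (Q - P)"])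
    fix p assume p: "p \<in> S"
    obtain W \<phi> e where ch: "smooth_chart W \<phi>" "p \<in> W" and e: "norm e = 1"
      and z: "\<And>x. x \<in> S \<inter> W \<Longrightarrow> \<phi> x \<bullet> e = 0"
      and tan: "\<And>w. frechet_derivative \<phi> (at p) w \<bullet> e = 0 \<Longrightarrow> w \<in> tangent_space S p"
      using slice_chart_tangent[OF S(2) p] by metis
    let ?D = "frechet_derivative \<phi> (at p)"
    have W: "open W" and sm: "smooth_on W \<phi>" using ch(1) unfolding smooth_chart_def by blast+
    have lin: "linear ?D"
      by (rule linear_frechet_derivative) (use smooth_on_C1[OF sm] ch(2) in simp)
    have "linear (\<lambda>w. ?D w \<bullet> e)"
      by (rule linearI) (simp_all add: linear_add[OF lin] linear_cmul[OF lin] inner_add_left)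
    moreover have "linear (\<lambda>w. \<nu> p \<bullet> w)" by (rule linearI) (simp_all add: inner_add_right)
    moreover have "\<nu> p \<bullet> w = 0" if "?D w \<bullet> e = 0" for w
      using tan[OF that] \<nu> p unfolding unit_normal_def by blast
    ultimately obtain k where k: "\<And>w. \<nu> p \<bullet> w = k * (?D w \<bullet> e)"
      by (rule linear_functional_ker_subset) auto
    \<comment> \<open>One half of \<open>\<eta>\<close> is spent on the chart, the other one on the variation of \<open>\<nu>\<close> near \<open>p\<close>.\<close>
    define m where "m = \<eta> / (2 * (\<bar>k\<bar> + 1))"
    have m: "0 < m" using \<eta> by (simp add: m_def)
    obtain r where r: "0 < r" "ball p r \<subseteq> W" "\<And>x y. x \<in> ball p r \<Longrightarrow> y \<in> ball p r \<Longrightarrow>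
      norm (\<phi> y - \<phi> x - ?D (y - x)) \<le> m * norm (y - x)"
      using C1_strictly_differentiable[OF W ch(2) smooth_on_C1[OF sm] m] by metis
    obtain s where s: "0 < s" "\<And>x. x \<in> S \<Longrightarrow> dist x p < s \<Longrightarrow> dist (\<nu> x) (\<nu> p) < \<eta> / 2"
      using unit_normal_continuous_on[OF \<nu>] p \<eta> unfolding continuous_on_iff by (meson half_gt_zero)
    have "\<bar>\<nu> P \<bullet> (Q - P)\<bar> \<le> \<eta> * norm (Q - P)"
      if PQ: "P \<in> S \<inter> ball p (min r s)" "Q \<in> S \<inter> ball p (min r s)" for P Q
    proof -
      have PQr: "P \<in> ball p r" "Q \<in> ball p r" using PQ by auto
      then have "\<phi> P \<bullet> e = 0" "\<phi> Q \<bullet> e = 0" using z PQ r(2) by blast+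
      then have "\<bar>?D (Q - P) \<bullet> e\<bar> = \<bar>(\<phi> Q - \<phi> P - ?D (Q - P)) \<bullet> e\<bar>"
        by (simp add: inner_diff_left)
      also have "\<dots> \<le> norm (\<phi> Q - \<phi> P - ?D (Q - P)) * norm e" by (rule Cauchy_Schwarz_ineq2)
      also have "\<dots> \<le> m * norm (Q - P)" using r(3)[OF PQr] e by simp
      finally have "\<bar>k\<bar> * \<bar>?D (Q - P) \<bullet> e\<bar> \<le> \<bar>k\<bar> * (m * norm (Q - P))" by (intro mult_left_mono) auto
      also have "\<dots> = (\<bar>k\<bar> * m) * norm (Q - P)" by simp
      also have "\<dots> \<le> (\<eta> / 2) * norm (Q - P)"
      proof (rule mult_right_mono)
        show "\<bar>k\<bar> * m \<le> \<eta> / 2" using \<eta> by (simp add: m_def field_simps)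
      qed simp
      finally have 1: "\<bar>\<nu> p \<bullet> (Q - P)\<bar> \<le> (\<eta> / 2) * norm (Q - P)" by (simp add: k abs_mult)
      have "\<bar>(\<nu> P - \<nu> p) \<bullet> (Q - P)\<bar> \<le> norm (\<nu> P - \<nu> p) * norm (Q - P)" by (rule Cauchy_Schwarz_ineq2)
      also have "\<dots> \<le> (\<eta> / 2) * norm (Q - P)"
        using s(2)[of P] PQ by (intro mult_right_mono) (auto simp: dist_norm norm_minus_commute less_imp_le)
      finally have "\<bar>(\<nu> P - \<nu> p) \<bullet> (Q - P)\<bar> \<le> (\<eta> / 2) * norm (Q - P)" .
      then show ?thesis using 1 unfolding inner_diff_left by linarith
    qed
    then show "\<exists>r>0. \<exists>L::real. \<forall>x\<in>S \<inter> ball p r. \<forall>y\<in>S \<inter> ball p r. \<bar>\<nu> x \<bullet> (y - x)\<bar> \<le> \<eta> * norm (y - x)"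
      using r(1) s(1) by (intro exI[of _ "min r s"]) auto
  qed blast+
  then show thesis using that by blast
qed

section \<open>The normal projection on fine meshes\<close>

lemma nproj_normal_point:
  assumes sd: "signed_distance S \<nu> \<epsilon> \<delta>" and P: "P \<in> S" "\<bar>s\<bar> \<le> \<epsilon>"
  shows "nproj S \<nu> \<delta> (P + s *\<^sub>R \<nu> P) = P" "\<delta> (P + s *\<^sub>R \<nu> P) = s"
proof -
  show \<delta>: "\<delta> (P + s *\<^sub>R \<nu> P) = s" using sd P unfolding signed_distance_def by blast
  have inj: "inj_on (\<lambda>(P, s). P + s *\<^sub>R \<nu> P) (S \<times> {-\<epsilon>..\<epsilon>})"
    using sd unfolding signed_distance_def by blast
  show "nproj S \<nu> \<delta> (P + s *\<^sub>R \<nu> P) = P"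
    unfolding nproj_def \<delta>
  proof (rule the_equality)
    fix Q assume Q: "Q \<in> S \<and> P + s *\<^sub>R \<nu> P = Q + s *\<^sub>R \<nu> Q"
    have "(P, s) = (Q, s)" by (rule inj_onD[OF inj]) (use Q P in auto)
    then show "Q = P" by simp
  qed (use P in simp)
qed

lemma nproj_tube:
  assumes sd: "signed_distance S \<nu> \<epsilon> \<delta>" and x: "x \<in> tube S \<nu> \<epsilon>"
  shows "nproj S \<nu> \<delta> x \<in> S" "x = nproj S \<nu> \<delta> x + \<delta> x *\<^sub>R \<nu> (nproj S \<nu> \<delta> x)" "\<bar>\<delta> x\<bar> \<le> \<epsilon>"
proof -
  obtain P s where P: "P \<in> S" "\<bar>s\<bar> \<le> \<epsilon>" "x = P + s *\<^sub>R \<nu> P" using x unfolding tube_def by blast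
  note 1 = nproj_normal_point[OF sd P(1,2), folded P(3)]
  show "nproj S \<nu> \<delta> x \<in> S" "x = nproj S \<nu> \<delta> x + \<delta> x *\<^sub>R \<nu> (nproj S \<nu> \<delta> x)" "\<bar>\<delta> x\<bar> \<le> \<epsilon>"
    using P(1,2) by (simp_all add: 1 P(3)[symmetric])
qed

lemma nproj_id:
  assumes sd: "signed_distance S \<nu> \<epsilon> \<delta>" and P: "P \<in> S"
  shows "nproj S \<nu> \<delta> P = P"
proof -
  have "0 < \<epsilon>" using sd unfolding signed_distance_def by blast
  then show ?thesis using nproj_normal_point(1)[OF sd P, of 0] by simp
qed

text \<open>The tube is the continuous injective image of a compact set, so the inverse map, whose components are
  the projection and \<open>\<delta>\<close>, is continuous.\<close>

lemma
  assumes sd: "signed_distance S \<nu> \<epsilon> \<delta>" and S: "compact S" and \<nu>: "unit_normal S \<nu>"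
  shows compact_tube: "compact (tube S \<nu> \<epsilon>)"
    and continuous_on_nproj: "continuous_on (tube S \<nu> \<epsilon>) (nproj S \<nu> \<delta>)"
proof -
  let ?G = "\<lambda>(P, s). P + s *\<^sub>R \<nu> P" and ?D = "S \<times> {-\<epsilon>..\<epsilon>}"
  have cont: "continuous_on ?D ?G"
    unfolding case_prod_beta
    by (intro continuous_intros continuous_on_compose2[OF unit_normal_continuous_on[OF \<nu>]]) auto
  have comp: "compact ?D" by (intro compact_Times S compact_Icc)
  have tube: "tube S \<nu> \<epsilon> = ?G ` ?D"
    unfolding tube_def by (auto simp: abs_le_iff image_iff) (metis minus_le_iff)+
  show "compact (tube S \<nu> \<epsilon>)" unfolding tube by (rule compact_continuous_image[OF cont comp])
  have "continuous_on (?G ` ?D) (\<lambda>x. (nproj S \<nu> \<delta> x, \<delta> x))"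
    by (rule continuous_on_inv[OF cont comp]) (auto simp: nproj_normal_point[OF sd])
  then show "continuous_on (tube S \<nu> \<epsilon>) (nproj S \<nu> \<delta>)"
    unfolding tube using continuous_on_fst by fastforce
qed

lemma affine_hull_simplex_hyperplane:
  fixes T :: "'a::euclidean_space set"
  assumes T: "int d simplex T" and dim: "DIM('a) = d + 1"
    and n: "n \<noteq> 0" "\<And>x y. x \<in> T \<Longrightarrow> y \<in> T \<Longrightarrow> n \<bullet> (x - y) = 0" and x: "x \<in> T"
  shows "affine hull T = {y. n \<bullet> y = n \<bullet> x}"
proof (rule affine_dim_equal)
  show "affine {y. n \<bullet> y = n \<bullet> x}" by (rule affine_hyperplane)
  show "affine hull T \<noteq> {}" using x by auto
  show "affine hull T \<subseteq> {y. n \<bullet> y = n \<bullet> x}"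
  proof (rule hull_minimal)
    show "T \<subseteq> {y. n \<bullet> y = n \<bullet> x}" using n(2)[OF _ x] by (auto simp: inner_diff_right)
  qed (rule affine_hyperplane)
  show "aff_dim (affine hull T) = aff_dim {y. n \<bullet> y = n \<bullet> x}"
    using aff_dim_simplex[OF T] n(1) dim by simp
qed simp

text \<open>If all vertices deviate from the plane through \<open>B\<close> with normal \<open>N\<close> by at most a quarter of the
  inradius \<open>r\<close>, then so does the in-ball; moving from its center in the direction of the tangential part
  of \<open>N\<close> shows that this part has length at most \<open>1/4\<close>.\<close>

lemma simplex_normal_close:
  fixes T :: "'a::euclidean_space set"
  assumes T: "int d simplex T" and dim: "DIM('a) = d + 1"
    and n: "norm n = 1" "\<And>x y. x \<in> T \<Longrightarrow> y \<in> T \<Longrightarrow> n \<bullet> (x - y) = 0"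
    and r: "0 < r" "x0 \<in> T" "cball x0 r \<inter> affine hull T \<subseteq> T"
    and N: "norm N = 1" and dev: "\<And>v. v extreme_point_of T \<Longrightarrow> \<bar>N \<bullet> (v - B)\<bar> \<le> r / 4"
  shows "3 / 4 \<le> \<bar>N \<bullet> n\<bar>"
proof -
  define \<tau> where "\<tau> = N - (N \<bullet> n) *\<^sub>R n"
  have nn: "n \<bullet> n = 1" using n(1) by (simp add: norm_eq_1)
  have n0: "n \<noteq> 0" using n(1) by auto
  have n\<tau>: "n \<bullet> \<tau> = 0" using nn by (simp add: \<tau>_def inner_diff_right inner_commute)
  have N\<tau>: "N \<bullet> \<tau> = (norm \<tau>)\<^sup>2"
  proof -
    have "N = \<tau> + (N \<bullet> n) *\<^sub>R n" by (simp add: \<tau>_def)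
    then have "N \<bullet> \<tau> = \<tau> \<bullet> \<tau> + (N \<bullet> n) * (n \<bullet> \<tau>)" by (metis inner_add_left inner_scaleR_left)
    then show ?thesis by (simp add: n\<tau> power2_norm_eq_inner)
  qed
  have dev': "\<bar>N \<bullet> (y - B)\<bar> \<le> r / 4" if y: "y \<in> T" for y
  proof -
    have y': "y \<in> convex hull {v. v extreme_point_of T}" using y simplex_extreme_points(3)[OF T] by simp
    have v: "N \<bullet> v - N \<bullet> B \<le> r / 4 \<and> - (r / 4) \<le> N \<bullet> v - N \<bullet> B" if "v \<in> {v. v extreme_point_of T}" for v
    proof -
      have "\<bar>N \<bullet> v - N \<bullet> B\<bar> \<le> r / 4" using dev[of v] that by (simp add: inner_diff_right)
      then show ?thesis by (intro conjI; linarith)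
    qed
    have "0 \<le> (- N) \<bullet> y + (r / 4 + N \<bullet> B)"
      by (rule affine_nonneg_on_convex_hull[OF _ y'], drule v) simp
    moreover have "0 \<le> N \<bullet> y + (r / 4 - N \<bullet> B)"
      by (rule affine_nonneg_on_convex_hull[OF _ y'], drule v) simp
    ultimately show ?thesis unfolding inner_diff_right inner_minus_left by linarith
  qed
  have hull: "affine hull T = {y. n \<bullet> y = n \<bullet> x0}"
    by (rule affine_hull_simplex_hyperplane[OF T dim n0]) (use n(2) r(2) in blast)+
  have "norm \<tau> \<le> 1 / 4"
  proof (cases "\<tau> = 0")
    case False
    define t where "t = r / norm \<tau>"
    have t: "t * norm \<tau> = r" "0 < t" using False r(1) by (simp_all add: t_def)
    have inT: "x0 + s *\<^sub>R \<tau> \<in> T" if "\<bar>s\<bar> = t" for s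
    proof -
      have "x0 + s *\<^sub>R \<tau> \<in> cball x0 r" using t that by (simp add: dist_norm)
      moreover have "x0 + s *\<^sub>R \<tau> \<in> affine hull T"
        unfolding hull by (simp add: inner_add_right n\<tau>)
      ultimately show ?thesis using r(3) by blast
    qed
    have "N \<bullet> (x0 + t *\<^sub>R \<tau> - B) - N \<bullet> (x0 + (- t) *\<^sub>R \<tau> - B) = 2 * (t * norm \<tau>) * norm \<tau>"
      by (simp add: inner_diff_right inner_add_right N\<tau> power2_eq_square)
    moreover have "N \<bullet> (x0 + t *\<^sub>R \<tau> - B) - N \<bullet> (x0 + (- t) *\<^sub>R \<tau> - B) \<le> r / 2"
    proof -
      have "x0 + t *\<^sub>R \<tau> \<in> T" "x0 + (- t) *\<^sub>R \<tau> \<in> T" using t(2) by (auto intro!: inT simp del: scaleR_minus_left)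
      from this[THEN dev'] show ?thesis by linarith
    qed
    ultimately have "r * (4 * norm \<tau>) \<le> r * 1" by (simp add: t(1))
    then show ?thesis using r(1) by simp
  qed simp
  then have "(norm \<tau>)\<^sup>2 \<le> (1/4)\<^sup>2" by (intro power_mono) auto
  moreover have "(N \<bullet> n)\<^sup>2 = 1 - (norm \<tau>)\<^sup>2"
  proof -
    have "(norm \<tau>)\<^sup>2 = N \<bullet> N - (N \<bullet> n)\<^sup>2"
      unfolding N\<tau>[symmetric] by (simp add: \<tau>_def inner_diff_right power2_eq_square inner_commute)
    then show ?thesis using N by (simp add: norm_eq_1)
  qed
  ultimately have "(3/4)\<^sup>2 \<le> \<bar>N \<bullet> n\<bar>\<^sup>2" by (simp add: power2_eq_square)
  then show ?thesis by (rule power2_le_imp_le) simp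
qed

text \<open>On small simplices the normal projection has a Lipschitz inverse. The vertices lie on \<open>S\<close>,
  so by flatness of \<open>S\<close> and the lower bound on the inradius the simplex is transversal to the
  normals of \<open>S\<close>; hence two points of the simplex cannot differ in normal direction only.\<close>

lemma nproj_expanding_on_fine_mesh:
  fixes S :: "'a::euclidean_space set"
  assumes dim: "DIM('a) = d + 1" and S: "compact S" "smooth_hypersurface S" "unit_normal S \<nu>"
    and sd: "signed_distance S \<nu> \<epsilon> \<delta>" and c: "0 < c"
  obtains h0 K where "0 < h0" "0 < K"
    "\<And>h \<T> T x y. 0 < h \<Longrightarrow> h < h0 \<Longrightarrow> admissible_mesh d S \<nu> \<epsilon> \<delta> c h \<T> \<Longrightarrow> T \<in> \<T> \<Longrightarrow>
        x \<in> T \<Longrightarrow> y \<in> T \<Longrightarrow> dist x y \<le> K * dist (nproj S \<nu> \<delta> x) (nproj S \<nu> \<delta> y)"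
proof -
  define pr where "pr = nproj S \<nu> \<delta>"
  let ?U = "tube S \<nu> \<epsilon>"
  have \<epsilon>: "0 < \<epsilon>" using sd unfolding signed_distance_def by blast
  obtain \<rho>1 where \<rho>1: "0 < \<rho>1"
    "\<And>P Q. P \<in> S \<Longrightarrow> Q \<in> S \<Longrightarrow> dist P Q < \<rho>1 \<Longrightarrow> \<bar>\<nu> P \<bullet> (Q - P)\<bar> \<le> c / 4 * norm (Q - P)"
    by (rule unit_normal_secant[OF S, of "c / 4"]) (use c in auto)
  obtain \<rho>2 L where \<rho>2: "0 < \<rho>2" "0 \<le> L"
    "\<And>P Q. P \<in> S \<Longrightarrow> Q \<in> S \<Longrightarrow> dist P Q < \<rho>2 \<Longrightarrow> norm (\<nu> P - \<nu> Q) \<le> L * norm (P - Q)"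
    using unit_normal_Lipschitz[OF S(1,3)] by metis
  have pr_cont: "continuous_on ?U pr" unfolding pr_def by (rule continuous_on_nproj[OF sd S(1,3)])
  have prS: "pr x \<in> S" if "x \<in> ?U" for x using nproj_tube(1)[OF sd that] by (simp add: pr_def)
  have "uniformly_continuous_on ?U pr"
    by (rule compact_uniformly_continuous[OF pr_cont compact_tube[OF sd S(1,3)]])
  then obtain \<rho>3 where \<rho>3: "0 < \<rho>3" "\<And>x y. x \<in> ?U \<Longrightarrow> y \<in> ?U \<Longrightarrow> dist x y < \<rho>3 \<Longrightarrow> dist (pr x) (pr y) < \<rho>2"
    using \<rho>2(1) unfolding uniformly_continuous_on_def by metis
  have "continuous_on ?U (\<lambda>x. \<nu> (pr x))"
    by (rule continuous_on_compose2[OF unit_normal_continuous_on[OF S(3)] pr_cont]) (use prS in blast)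
  then have "uniformly_continuous_on ?U (\<lambda>x. \<nu> (pr x))"
    by (rule compact_uniformly_continuous[OF _ compact_tube[OF sd S(1,3)]])
  moreover have "(0::real) < 1 / 4" by simp
  ultimately obtain \<rho>4 where \<rho>4: "0 < \<rho>4"
    "\<And>x y. x \<in> ?U \<Longrightarrow> y \<in> ?U \<Longrightarrow> dist x y < \<rho>4 \<Longrightarrow> dist (\<nu> (pr x)) (\<nu> (pr y)) < 1 / 4"
    unfolding uniformly_continuous_on_def by metis
  define h0 where "h0 = min \<rho>1 (min \<rho>3 \<rho>4)"
  define K where "K = 3 * (1 + \<epsilon> * L)"
  have "dist x y \<le> K * dist (pr x) (pr y)"
    if h: "0 < h" "h < h0" and mesh: "admissible_mesh d S \<nu> \<epsilon> \<delta> c h \<T>" and T: "T \<in> \<T>"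
      and xy: "x \<in> T" "y \<in> T" for h \<T> T x y
  proof -
    have Ts: "int d simplex T" and tub: "\<Union>\<T> \<subseteq> ?U" and vS: "mesh_vertices \<T> \<subseteq> S"
      and fin: "finite \<T>" and hmax: "h = Max (diameter ` \<T>)"
      using mesh T unfolding admissible_mesh_def triangulation_def by blast+
    obtain x0 where x0: "x0 \<in> T" "cball x0 (c * h) \<inter> affine hull T \<subseteq> T"
      using mesh T unfolding admissible_mesh_def by blast
    have "diameter T \<le> h" unfolding hmax using fin T by simp
    moreover have "bounded T" using compact_simplex[OF Ts] compact_imp_bounded by blast
    ultimately have dist: "dist a b \<le> h" if "a \<in> T" "b \<in> T" for a b
      using diameter_bounded_bound[of T a b] that by simp
    have TU: "a \<in> ?U" if "a \<in> T" for a using that T tub by blast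
    obtain n where n: "norm n = 1" "\<And>x y. x \<in> T \<Longrightarrow> y \<in> T \<Longrightarrow> n \<bullet> (x - y) = 0"
      by (rule simplex_unit_normal[OF Ts dim]) (rule that)
    have "{v. v extreme_point_of T} \<noteq> {}"
      using simplex_extreme_points(3)[OF Ts] x0(1) by fastforce
    then obtain B where B: "B extreme_point_of T" by blast
    have vertex: "v \<in> S" "v \<in> T" if "v extreme_point_of T" for v
      using that T vS by (auto simp: mesh_vertices_def extreme_point_of_def)
    have prB: "pr B = B" unfolding pr_def by (rule nproj_id[OF sd vertex(1)[OF B]])
    have nB: "norm (\<nu> B) = 1" using S(3) vertex(1)[OF B] unfolding unit_normal_def by blast
    have "3 / 4 \<le> \<bar>\<nu> B \<bullet> n\<bar>"
    proof (rule simplex_normal_close[OF Ts dim n _ x0 nB])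
      show "0 < c * h" using c h(1) by simp
      fix v assume v: "v extreme_point_of T"
      have "dist B v \<le> h" by (rule dist[OF vertex(2)[OF B] vertex(2)[OF v]])
      then have "\<bar>\<nu> B \<bullet> (v - B)\<bar> \<le> c / 4 * norm (v - B)"
        by (intro \<rho>1(2) vertex B v) (use h(2) in \<open>auto simp: h0_def\<close>)
      also have "\<dots> \<le> c / 4 * h"
        using \<open>dist B v \<le> h\<close> c by (intro mult_left_mono) (auto simp: dist_norm norm_minus_commute)
      finally show "\<bar>\<nu> B \<bullet> (v - B)\<bar> \<le> c * h / 4" by simp
    qed
    moreover have "\<bar>(\<nu> (pr y) - \<nu> B) \<bullet> n\<bar> \<le> 1 / 4"
    proof -
      have "dist y B < \<rho>4" using dist[OF xy(2) vertex(2)[OF B]] h(2) by (simp add: h0_def)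
      then have "norm (\<nu> (pr y) - \<nu> B) < 1 / 4"
        using \<rho>4(2)[OF TU[OF xy(2)] TU[OF vertex(2)[OF B]]] by (simp add: prB dist_norm)
      moreover have "\<bar>(\<nu> (pr y) - \<nu> B) \<bullet> n\<bar> \<le> norm (\<nu> (pr y) - \<nu> B) * norm n" by (rule Cauchy_Schwarz_ineq2)
      ultimately show ?thesis using n(1) by simp
    qed
    ultimately have trans: "1 / 2 \<le> \<bar>\<nu> (pr y) \<bullet> n\<bar>" unfolding inner_diff_left by linarith
    \<comment> \<open>The difference \<open>x - y\<close> is the sum of \<open>A\<close>, which is controlled by the projections, and of a multiple
      \<open>\<sigma>\<close> of one normal of \<open>S\<close>. Since \<open>x - y\<close> is orthogonal to \<open>n\<close> but this normal is not, \<open>\<bar>\<sigma>\<bar>\<close> is at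
      most twice the norm of \<open>A\<close>, whence the factor 3 in \<open>K\<close>.\<close>
    define A where "A = (pr x - pr y) + \<delta> x *\<^sub>R (\<nu> (pr x) - \<nu> (pr y))"
    define \<sigma> where "\<sigma> = \<delta> x - \<delta> y"
    have x: "x = pr x + \<delta> x *\<^sub>R \<nu> (pr x)" and y: "y = pr y + \<delta> y *\<^sub>R \<nu> (pr y)" and \<delta>x: "\<bar>\<delta> x\<bar> \<le> \<epsilon>"
      using nproj_tube(2,3)[OF sd TU] xy unfolding pr_def by blast+
    have eq: "x - y = A + \<sigma> *\<^sub>R \<nu> (pr y)"
    proof -
      have "x - y = (pr x + \<delta> x *\<^sub>R \<nu> (pr x)) - (pr y + \<delta> y *\<^sub>R \<nu> (pr y))" using x y by simp
      then show ?thesis by (simp add: A_def \<sigma>_def scaleR_diff_left scaleR_diff_right)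
    qed
    have "dist (pr x) (pr y) < \<rho>2"
      by (rule \<rho>3(2)[OF TU TU]) (use dist[of x y] xy h(2) in \<open>auto simp: h0_def\<close>)
    then have "norm (\<nu> (pr x) - \<nu> (pr y)) \<le> L * norm (pr x - pr y)"
      by (intro \<rho>2(3) prS TU xy)
    then have "\<bar>\<delta> x\<bar> * norm (\<nu> (pr x) - \<nu> (pr y)) \<le> \<epsilon> * (L * norm (pr x - pr y))"
      using \<delta>x \<epsilon> by (intro mult_mono) auto
    then have A: "norm A \<le> (1 + \<epsilon> * L) * norm (pr x - pr y)"
    proof -
      have "norm A \<le> norm (pr x - pr y) + norm (\<delta> x *\<^sub>R (\<nu> (pr x) - \<nu> (pr y)))"
        unfolding A_def by (rule norm_triangle_ineq)
      also have "\<dots> \<le> norm (pr x - pr y) + \<epsilon> * (L * norm (pr x - pr y))"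
        using \<open>\<bar>\<delta> x\<bar> * norm (\<nu> (pr x) - \<nu> (pr y)) \<le> \<epsilon> * (L * norm (pr x - pr y))\<close>
        unfolding norm_scaleR by linarith
      finally show ?thesis by (simp add: distrib_right)
    qed
    have "0 = n \<bullet> A + \<sigma> * (\<nu> (pr y) \<bullet> n)"
      using n(2)[OF xy] unfolding eq by (simp add: inner_add_right inner_commute)
    then have "\<bar>\<sigma>\<bar> * \<bar>\<nu> (pr y) \<bullet> n\<bar> = \<bar>n \<bullet> A\<bar>" unfolding abs_mult[symmetric] by linarith
    also have "\<dots> \<le> norm A" using Cauchy_Schwarz_ineq2[of n A] n(1) by simp
    finally have "\<bar>\<sigma>\<bar> * \<bar>\<nu> (pr y) \<bullet> n\<bar> \<le> norm A" .
    moreover have "\<bar>\<sigma>\<bar> * (1 / 2) \<le> \<bar>\<sigma>\<bar> * \<bar>\<nu> (pr y) \<bullet> n\<bar>" using trans by (intro mult_left_mono) auto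
    ultimately have \<sigma>: "\<bar>\<sigma>\<bar> \<le> 2 * norm A" by simp
    have "norm (\<nu> (pr y)) = 1" using S(3) prS[OF TU[OF xy(2)]] unfolding unit_normal_def by blast
    then have "norm (x - y) \<le> norm A + \<bar>\<sigma>\<bar>"
      unfolding eq using norm_triangle_ineq[of A "\<sigma> *\<^sub>R \<nu> (pr y)"] by simp
    then have "norm (x - y) \<le> 3 * norm A" using \<sigma> by simp
    moreover have "3 * norm A \<le> K * norm (pr x - pr y)" using A by (simp only: K_def mult.assoc)
    ultimately show ?thesis by (simp add: dist_norm)
  qed
  moreover have "0 < h0" using \<rho>1(1) \<rho>3(1) \<rho>4(1) by (simp add: h0_def)
  moreover have "0 < K" using \<epsilon> \<rho>2(2) by (simp add: K_def add_pos_nonneg)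
  ultimately show thesis using that unfolding pr_def by blast
qed

text \<open>On each \<open>T\<close> the exceptional set is the image of a null set under the Lipschitz inverse of \<open>P\<close>.\<close>

lemma AE_hausdorff_expanding_pullback:
  fixes P :: "'a::metric_space \<Rightarrow> 'b::metric_space"
  assumes d: "1 \<le> d" and fin: "finite \<T>" and K: "0 < K"
    and exp: "\<And>T x y. T \<in> \<T> \<Longrightarrow> x \<in> T \<Longrightarrow> y \<in> T \<Longrightarrow> dist x y \<le> K * dist (P x) (P y)"
    and P: "P ` \<Union>\<T> \<subseteq> S" and ae: "AE y in hausdorff d. y \<in> S \<longrightarrow> Q y"
  shows "AE x in hausdorff d. x \<in> \<Union>\<T> \<longrightarrow> Q (P x)"
proof -
  obtain N where N: "{y \<in> space (hausdorff d). \<not> (y \<in> S \<longrightarrow> Q y)} \<subseteq> N" "N \<in> null_sets (hausdorff d)"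
    using ae unfolding eventually_ae_filter by blast
  define A where "A T = {x \<in> T. \<not> Q (P x)}" for T
  have "A T \<in> null_sets (hausdorff d)" if T: "T \<in> \<T>" for T
  proof -
    have inj: "inj_on P T"
    proof (rule inj_onI)
      fix x y assume "x \<in> T" "y \<in> T" "P x = P y"
      then show "x = y" using exp[OF T, of x y] by simp
    qed
    have "P ` A T \<subseteq> N"
      using N(1) P T by (auto simp: A_def space_hausdorff[OF d])
    then have "hausdorff_outer d (P ` A T) \<le> hausdorff_outer d N" by (rule hausdorff_outer_mono)
    then have 0: "hausdorff_outer d (P ` A T) = 0"
      using N(2) null_sets_hausdorff_iff[OF d, of N] by simp
    have "hausdorff_outer d (inv_into T P ` (P ` A T)) = 0"
    proof (rule hausdorff_outer_Lipschitz_null[OF K _ 0])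
      fix y z assume "y \<in> P ` A T" "z \<in> P ` A T"
      then show "dist (inv_into T P y) (inv_into T P z) \<le> K * dist y z"
        using exp[OF T] by (auto simp: A_def inv_into_f_f[OF inj])
    qed
    moreover have "inv_into T P ` (P ` A T) = A T"
      using inj by (intro inv_into_image_cancel) (auto simp: A_def)
    ultimately show ?thesis by (simp add: null_sets_hausdorff_iff[OF d])
  qed
  then have "(\<Union>T\<in>\<T>. A T) \<in> null_sets (hausdorff d)"
    using fin by (intro null_sets_UN') (auto intro: countable_finite)
  then show ?thesis by (rule AE_I') (auto simp: A_def)
qed

text \<open>A convex set is contained in the dilation of its relative interior by the factor 2 from an interior
  point.\<close>

lemma hausdorff_null_rel_interior:
  fixes T :: "'a::euclidean_space set"
  assumes T: "convex T" and null: "hausdorff_outer d (rel_interior T) = 0" and ne: "T \<noteq> {}"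
  shows "hausdorff_outer d T = 0"
proof -
  obtain z where z: "z \<in> rel_interior T" using rel_interior_eq_empty[OF T] ne by blast
  define f where "f w = z + 2 *\<^sub>R (w - z)" for w
  have "T \<subseteq> f ` rel_interior T"
  proof
    fix x assume x: "x \<in> T"
    have "x - (1/2) *\<^sub>R (x - z) \<in> rel_interior T"
      by (rule rel_interior_convex_shrink[OF T z x]) auto
    moreover have "f (x - (1/2) *\<^sub>R (x - z)) = x" by (simp add: f_def algebra_simps scaleR_2)
    ultimately show "x \<in> f ` rel_interior T" by (metis imageI)
  qed
  then have "hausdorff_outer d T \<le> hausdorff_outer d (f ` rel_interior T)" by (rule hausdorff_outer_mono)
  also have "\<dots> = 0"
  proof (rule hausdorff_outer_Lipschitz_null[OF _ _ null])
    show "dist (f x) (f y) \<le> 2 * dist x y" for x y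
    proof -
      have "f x - f y = 2 *\<^sub>R (x - y)" by (simp add: f_def algebra_simps)
      then show ?thesis by (simp add: dist_norm)
    qed
  qed simp
  finally show ?thesis by simp
qed

section \<open>The discrete maximum principle\<close>

lemma borel_measurable_hausdorff:
  assumes d: "1 \<le> d" and f: "f \<in> borel_measurable borel"
  shows "f \<in> borel_measurable (hausdorff d :: 'a::metric_space measure)"
proof -
  have "(\<lambda>x. x) \<in> measurable (hausdorff d :: 'a measure) borel"
  proof (rule measurableI)
    show "(\<lambda>x. x) -` A \<inter> space (hausdorff d) \<in> sets (hausdorff d :: 'a measure)" if "A \<in> sets borel" for A
      using that borel_subset_sets_hausdorff[OF d] by (auto simp: space_hausdorff[OF d])
  qed simp
  from measurable_compose[OF this f] show ?thesis .
qed

lemma set_integrable_hausdorff_continuous_on: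
  fixes \<phi> :: "'a::euclidean_space \<Rightarrow> real"
  assumes d: "1 \<le> d" and K: "compact K" "emeasure (hausdorff d) K < \<infinity>" and \<phi>: "continuous_on K \<phi>"
  shows "set_integrable (hausdorff d) K \<phi>"
proof -
  have Kb: "K \<in> sets borel" by (rule borel_closed[OF compact_imp_closed[OF K(1)]])
  obtain B where B: "\<And>x. x \<in> K \<Longrightarrow> norm (\<phi> x) \<le> B"
    using compact_imp_bounded[OF compact_continuous_image[OF \<phi> K(1)]] unfolding bounded_iff by auto
  show ?thesis
    unfolding set_integrable_def
  proof (rule integrableI_bounded_set)
    show "K \<in> sets (hausdorff d)" by (rule subsetD[OF borel_subset_sets_hausdorff[OF d] Kb])
    show "(\<lambda>x. indicator K x *\<^sub>R \<phi> x) \<in> borel_measurable (hausdorff d)"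
      by (intro borel_measurable_hausdorff d borel_measurable_continuous_on_indicator Kb \<phi>)
    show "AE x in hausdorff d. x \<in> K \<longrightarrow> norm (indicator K x *\<^sub>R \<phi> x) \<le> B" using B by (intro AE_I2) auto
  qed (use K in auto)
qed

lemma rel_interior_borel: "rel_interior (T::'a::euclidean_space set) \<in> sets borel"
proof -
  have "openin (top_of_set (affine hull T)) (rel_interior T)" by (rule openin_rel_interior)
  then obtain U where "open U" "rel_interior T = affine hull T \<inter> U" unfolding openin_open by blast
  then show ?thesis using closed_affine_hull[of T] by (auto intro!: sets.Int)
qed

context simplicial_mesh
begin

lemma emeasure_mesh_finite:
  assumes d: "1 \<le> d" and fin: "\<And>T. T \<in> \<T> \<Longrightarrow> emeasure (hausdorff d) T < \<infinity>"
  shows "emeasure (hausdorff d) (\<Union>\<T>) < \<infinity>"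
proof -
  have "T \<in> sets (hausdorff d)" if "T \<in> \<T>" for T
    by (rule subsetD[OF borel_subset_sets_hausdorff[OF d] borel_closed[OF compact_imp_closed[OF compact_elem[OF that]]]])
  then have "emeasure (hausdorff d) (\<Union>T\<in>\<T>. T) \<le> (\<Sum>T\<in>\<T>. emeasure (hausdorff d) T)"
    by (intro emeasure_subadditive_finite finite_mesh) auto
  also have "\<dots> < \<infinity>" using fin finite_mesh by (auto simp: less_top[symmetric])
  finally show ?thesis by simp
qed

lemma piecewise_continuous_integrable:
  fixes F :: "'a \<Rightarrow> real"
  assumes d: "1 \<le> d" and fin: "\<And>T. T \<in> \<T> \<Longrightarrow> emeasure (hausdorff d) T < \<infinity>"
    and \<phi>: "\<And>T. T \<in> \<T> \<Longrightarrow> continuous_on T (\<phi> T)" and \<psi>: "continuous_on (\<Union>\<T>) \<psi>"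
    and inside: "\<And>T x. T \<in> \<T> \<Longrightarrow> x \<in> rel_interior T \<Longrightarrow> F x = \<phi> T x + \<psi> x"
    and interface: "\<And>x. x \<in> \<Union>\<T> \<Longrightarrow> (\<And>T. T \<in> \<T> \<Longrightarrow> x \<notin> rel_interior T) \<Longrightarrow> F x = \<psi> x"
  shows "set_integrable (hausdorff d) (\<Union>\<T>) F"
proof -
  have 1: "set_integrable (hausdorff d) (rel_interior T) (\<phi> T)" if T: "T \<in> \<T>" for T
  proof (rule set_integrable_subset)
    show "set_integrable (hausdorff d) T (\<phi> T)"
      by (rule set_integrable_hausdorff_continuous_on[OF d compact_elem[OF T] fin[OF T] \<phi>[OF T]])
    show "rel_interior T \<in> sets (hausdorff d)"
      by (rule subsetD[OF borel_subset_sets_hausdorff[OF d] rel_interior_borel])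
  qed (rule rel_interior_subset)
  have 2: "set_integrable (hausdorff d) (\<Union>\<T>) \<psi>"
    by (rule set_integrable_hausdorff_continuous_on[OF d compact_mesh emeasure_mesh_finite[OF d fin] \<psi>])
  have "integrable (hausdorff d)
      (\<lambda>x. (\<Sum>T\<in>\<T>. indicator (rel_interior T) x *\<^sub>R \<phi> T x) + indicator (\<Union>\<T>) x *\<^sub>R \<psi> x)"
    using 1 2 unfolding set_integrable_def
    by (intro Bochner_Integration.integrable_add Bochner_Integration.integrable_sum) auto
  moreover have "(\<Sum>T\<in>\<T>. indicator (rel_interior T) x *\<^sub>R \<phi> T x) + indicator (\<Union>\<T>) x *\<^sub>R \<psi> x
      = indicator (\<Union>\<T>) x *\<^sub>R F x" for x
  proof (cases "\<exists>T\<in>\<T>. x \<in> rel_interior T")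
    case True
    then obtain T where T: "T \<in> \<T>" "x \<in> rel_interior T" by blast
    have "(\<Sum>T'\<in>\<T>. indicator (rel_interior T') x *\<^sub>R \<phi> T' x) = (\<Sum>T'\<in>{T}. indicator (rel_interior T') x *\<^sub>R \<phi> T' x)"
    proof (rule sum.mono_neutral_right[OF finite_mesh])
      have "x \<notin> rel_interior T'" if "T' \<in> \<T> - {T}" for T'
        using rel_interior_unique[OF T(1) _ T(2), of T'] that by blast
      then show "\<forall>T'\<in>\<T> - {T}. indicator (rel_interior T') x *\<^sub>R \<phi> T' x = 0" by simp
    qed (use T in simp)
    moreover have "x \<in> \<Union>\<T>" using T rel_interior_subset by blast
    ultimately show ?thesis using inside[OF T] T by simp
  next
    case False
    then have "(\<Sum>T\<in>\<T>. indicator (rel_interior T) x *\<^sub>R \<phi> T x) = 0" by (intro sum.neutral) auto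
    moreover have "indicator (\<Union>\<T>) x *\<^sub>R \<psi> x = indicator (\<Union>\<T>) x *\<^sub>R F x"
      using interface[of x] False by (cases "x \<in> \<Union>\<T>") simp_all
    ultimately show ?thesis by simp
  qed
  ultimately show ?thesis unfolding set_integrable_def by simp
qed

text \<open>A nonnegative integrand with nonpositive integral vanishes almost everywhere, hence cannot be
  bounded below by a positive constant on the interior of a simplex, which is not a null set.\<close>

lemma nonneg_integrand_elem_bound:
  fixes F :: "'a \<Rightarrow> real"
  assumes d: "1 \<le> d" and pos: "\<And>T. T \<in> \<T> \<Longrightarrow> 0 < emeasure (hausdorff d) T"
    and int: "set_integrable (hausdorff d) (\<Union>\<T>) F" and F: "\<And>x. x \<in> \<Union>\<T> \<Longrightarrow> 0 \<le> F x"
    and le: "(LINT x:\<Union>\<T>|hausdorff d. F x) \<le> 0"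
    and T: "T \<in> \<T>" and a: "\<And>x. x \<in> rel_interior T \<Longrightarrow> a \<le> F x"
  shows "a \<le> 0"
proof (rule ccontr)
  assume a0: "\<not> a \<le> 0"
  let ?F = "\<lambda>x. indicator (\<Union>\<T>) x *\<^sub>R F x"
  have nn: "0 \<le> ?F x" for x using F by (simp add: indicator_def)
  have int': "integrable (hausdorff d) ?F" using int by (simp add: set_integrable_def)
  have "(LINT x|hausdorff d. ?F x) = 0"
    using le nn by (intro antisym integral_nonneg_AE) (auto simp: set_lebesgue_integral_def)
  then have "AE x in hausdorff d. ?F x = 0"
    using integral_nonneg_eq_0_iff_AE[OF int'] nn by simp
  then obtain N where N: "{x \<in> space (hausdorff d). ?F x \<noteq> 0} \<subseteq> N" "N \<in> null_sets (hausdorff d)"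
    unfolding eventually_ae_filter by auto
  have "rel_interior T \<subseteq> N"
  proof
    fix x assume x: "x \<in> rel_interior T"
    then have "x \<in> \<Union>\<T>" using T rel_interior_subset by blast
    then have "indicator (\<Union>\<T>) x = (1::real)" by (rule indicator_simps)
    then have "?F x \<noteq> 0" using a[OF x] a0 by simp
    then show "x \<in> N" using N(1) by (simp add: space_hausdorff[OF d] subset_iff)
  qed
  then have "hausdorff_outer d (rel_interior T) \<le> hausdorff_outer d N" by (rule hausdorff_outer_mono)
  then have "hausdorff_outer d (rel_interior T) = 0"
    using N(2) null_sets_hausdorff_iff[OF d, of N] by simp
  then have "hausdorff_outer d T = 0"
    by (rule hausdorff_null_rel_interior[OF convex_elem[OF T] _ nonempty_elem[OF T]])
  then show False
    using null_sets_hausdorff_iff[OF d, of T] pos[OF T] by (auto simp: null_sets_def)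
qed

lemma grad_zero_imp_constant:
  assumes T: "T \<in> \<T>" and 0: "simplex_grad T (nodal_fun c) = 0" and xy: "x \<in> T" "y \<in> T"
  shows "nodal_fun c x = nodal_fun c y"
proof -
  obtain n where n: "norm n = 1" "\<And>x y. x \<in> T \<Longrightarrow> y \<in> T \<Longrightarrow> n \<bullet> (x - y) = 0"
    by (rule simplex_unit_normal[OF simplex[OF T] dim]) (rule that)
  have "simplex_grad T (nodal_fun c) \<bullet> (x - y) = nodal_fun c x - nodal_fun c y"
    by (rule simplex_grad_characterization(2)[OF simplex[OF T] dim n nodal_fun_affine[OF T] xy])
  then show ?thesis by (simp add: 0)
qed

lemma fe_space_eq: "fe_space \<T> = range nodal_fun"
  by (auto simp: fe_space_def nodal_fun_def[abs_def])

lemma nodal_fun_in_fe_space0: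
  assumes "\<And>B. B \<in> boundary_vertices \<T> \<Longrightarrow> c B = 0"
  shows "nodal_fun c \<in> fe_space0 \<T>"
proof -
  have "nodal_fun c x = (\<Sum>B\<in>inner_vertices \<T>. c B * hat \<T> B x)" for x
    unfolding nodal_fun_def
    by (rule sum.mono_neutral_right[OF finite_mesh_vertices])
      (use assms in \<open>auto simp: inner_vertices_def boundary_vertices_def\<close>)
  then have "nodal_fun c = (\<lambda>x. \<Sum>B\<in>inner_vertices \<T>. c B * hat \<T> B x)" by blast
  then show ?thesis unfolding fe_space0_def by blast
qed

lemma boundary_interp_eq: "boundary_interp \<T> g = nodal_fun (\<lambda>B. if B \<in> boundary_vertices \<T> then g B else 0)"
proof
  fix x
  show "boundary_interp \<T> g x = nodal_fun (\<lambda>B. if B \<in> boundary_vertices \<T> then g B else 0) x"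
    unfolding boundary_interp_def nodal_fun_def
    by (rule sum.mono_neutral_cong_left[OF finite_mesh_vertices]) (auto simp: boundary_vertices_def)
qed

lemma fe_space0_boundary_vertex:
  assumes "w \<in> fe_space0 \<T>" "B \<in> boundary_vertices \<T>"
  shows "w B = 0"
proof -
  obtain c where c: "w = (\<lambda>x. \<Sum>B\<in>inner_vertices \<T>. c B * hat \<T> B x)"
    using assms(1) unfolding fe_space0_def by blast
  have "hat \<T> B' B = 0" if "B' \<in> inner_vertices \<T>" for B'
    using that assms(2) hat_node[of B B'] by (auto simp: inner_vertices_def boundary_vertices_def)
  then show ?thesis unfolding c by (intro sum.neutral) auto
qed

lemma discrete_solution_boundary_value:
  assumes sol: "discrete_solution d' S \<nu> \<delta> b q f g \<T> u" and B: "B \<in> boundary_vertices \<T>"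
  shows "u B = g B"
proof -
  have ug: "(\<lambda>x. u x - boundary_interp \<T> g x) \<in> fe_space0 \<T>"
    using sol unfolding discrete_solution_def Let_def by blast
  have "boundary_interp \<T> g B = g B"
    unfolding boundary_interp_eq using B by (subst nodal_fun_node) (auto simp: boundary_vertices_def)
  then show ?thesis using fe_space0_boundary_vertex[OF ug B] by simp
qed

text \<open>Tested with the positive part \<open>v\<close> of \<open>u - k\<close>, the equation equates a nonnegative with a nonpositive
  integral, so that the gradient of \<open>v\<close> vanishes on every simplex. The topology of the surface enters
  through \<open>conn\<close> alone, which turns such a \<open>v\<close> into \<open>0\<close>.\<close>

lemma discrete_solution_le_boundary_values:
  assumes d: "1 \<le> d"
    and meas: "\<And>T. T \<in> \<T> \<Longrightarrow> 0 < emeasure (hausdorff d) T" "\<And>T. T \<in> \<T> \<Longrightarrow> emeasure (hausdorff d) T < \<infinity>"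
    and P: "continuous_on (\<Union>\<T>) (nproj S \<nu> \<delta>)" "nproj S \<nu> \<delta> ` \<Union>\<T> \<subseteq> S"
    and b: "continuous_on (S \<times> UNIV \<times> UNIV) (\<lambda>(x, z, \<xi>). b x z \<xi>)"
    and q: "continuous_on (S \<times> UNIV) (\<lambda>(x, z). q x z)"
    and b_pos: "0 < \<mu>" "\<And>x z \<xi>. x \<in> S \<Longrightarrow> \<mu> \<le> b x z \<xi>"
    and q_mono: "\<And>x z. x \<in> S \<Longrightarrow> q x 0 \<le> q x z"
    and sign: "AE x in hausdorff d. x \<in> \<Union>\<T> \<longrightarrow> f (nproj S \<nu> \<delta> x) - q (nproj S \<nu> \<delta> x) 0 \<le> 0"
    and acute: "\<And>B B' T. B \<in> inner_vertices \<T> \<Longrightarrow> B' \<in> mesh_vertices \<T> \<Longrightarrow> B \<noteq> B' \<Longrightarrow> T \<in> \<T> \<Longrightarrow>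
        B \<in> T \<Longrightarrow> B' \<in> T \<Longrightarrow> simplex_grad T (hat \<T> B) \<bullet> simplex_grad T (hat \<T> B') \<le> 0"
    and conn: "\<And>w :: 'a \<Rightarrow> real. continuous_on (\<Union>\<T>) w \<Longrightarrow> finite (w ` \<Union>\<T>) \<Longrightarrow>
        (\<And>x. x \<in> mesh_boundary \<T> \<Longrightarrow> w x = 0) \<Longrightarrow> (\<And>x. x \<in> \<Union>\<T> \<Longrightarrow> w x = 0)"
    and sol: "discrete_solution d S \<nu> \<delta> b q f g \<T> u"
    and k: "\<And>B. B \<in> boundary_vertices \<T> \<Longrightarrow> g B \<le> k"
    and x: "x \<in> \<Union>\<T>"
  shows "u x \<le> k"
proof -
  let ?M = "\<Union>\<T>"
  define pr where "pr = nproj S \<nu> \<delta>"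
  have u: "u \<in> fe_space \<T>"
    and weak: "\<And>v. v \<in> fe_space0 \<T> \<Longrightarrow>
      (LINT x:?M|hausdorff d. b (pr x) (u x) (mesh_grad \<T> u x) * (mesh_grad \<T> u x \<bullet> mesh_grad \<T> v x)
           + (q (pr x) (u x) - q (pr x) 0) * v x)
        = (LINT x:?M|hausdorff d. (f (pr x) - q (pr x) 0) * v x)"
    using sol unfolding discrete_solution_def Let_def pr_def by blast+
  obtain c where c: "u = nodal_fun c" using u fe_space_eq by blast
  note bv = discrete_solution_boundary_value[OF sol]
  have cg: "c B = g B" if B: "B \<in> boundary_vertices \<T>" for B
    using bv[OF B] B nodal_fun_node[of B c] by (simp add: c boundary_vertices_def)
  define vc where "vc B = max (c B - k) 0" for B
  define v where "v = nodal_fun vc"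
  have vc0: "vc B = 0" if "B \<in> boundary_vertices \<T>" for B
    using k[OF that] cg[OF that] by (simp add: vc_def)
  have v_nonneg: "0 \<le> v x" if "x \<in> ?M" for x
    using nodal_fun_mono[OF that, of "\<lambda>_. 0" vc] nodal_fun_const[OF that, of 0] by (simp add: v_def vc_def)
  have v0: "v \<in> fe_space0 \<T>" unfolding v_def by (rule nodal_fun_in_fe_space0) (rule vc0)
  define F where "F x = b (pr x) (u x) (mesh_grad \<T> u x) * (mesh_grad \<T> u x \<bullet> mesh_grad \<T> v x)
           + (q (pr x) (u x) - q (pr x) 0) * v x" for x
  define \<phi> where "\<phi> T x = b (pr x) (u x) (simplex_grad T u) * (simplex_grad T u \<bullet> simplex_grad T v)" for T x
  define \<psi> where "\<psi> x = (q (pr x) (u x) - q (pr x) 0) * v x" for x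
  have prS: "pr x \<in> S" if "x \<in> ?M" for x using P(2) that by (auto simp: pr_def)
  have cont: "continuous_on ?M pr" "continuous_on ?M u" "continuous_on ?M v"
    using P(1) continuous_on_nodal_fun by (simp_all add: pr_def c v_def)
  have F_in: "F x = \<phi> T x + \<psi> x" if "T \<in> \<T>" "x \<in> rel_interior T" for T x
    using that by (simp add: F_def \<phi>_def \<psi>_def mesh_grad_rel_interior)
  have F_out: "F x = \<psi> x" if "x \<in> ?M" "\<And>T. T \<in> \<T> \<Longrightarrow> x \<notin> rel_interior T" for x
  proof -
    have "mesh_grad \<T> u x = 0" using that(2) unfolding mesh_grad_def by auto
    then show ?thesis by (simp add: F_def \<psi>_def)
  qed
  have energy: "\<mu> * (norm (simplex_grad T v))\<^sup>2 \<le> \<phi> T x" if T: "T \<in> \<T>" and x: "x \<in> ?M" for T x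
  proof -
    have "(norm (simplex_grad T v))\<^sup>2 \<le> simplex_grad T u \<bullet> simplex_grad T v"
      unfolding c v_def vc_def
      by (rule grad_positive_part_le[OF T]) (use k cg acute[OF _ _ _ T] in auto)
    then show ?thesis
      unfolding \<phi>_def using b_pos(1) b_pos(2)[OF prS[OF x]] by (intro mult_mono) (auto intro: order_trans less_imp_le)
  qed
  have reaction: "0 \<le> \<psi> x" if "x \<in> ?M" for x
    unfolding \<psi>_def using q_mono[OF prS[OF that]] v_nonneg[OF that] by simp
  have F_ge: "\<mu> * (norm (simplex_grad T v))\<^sup>2 \<le> F x" if T: "T \<in> \<T>" and x: "x \<in> rel_interior T" for T x
  proof -
    have "x \<in> ?M" using T x rel_interior_subset by blast
    then show ?thesis using F_in[OF T x] energy[OF T] reaction by fastforce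
  qed
  have F_nonneg: "0 \<le> F x" if x: "x \<in> ?M" for x
  proof (cases "\<exists>T\<in>\<T>. x \<in> rel_interior T")
    case True
    then obtain T where T: "T \<in> \<T>" "x \<in> rel_interior T" by blast
    have "0 \<le> \<mu> * (norm (simplex_grad T v))\<^sup>2" using b_pos(1) by simp
    then show ?thesis using F_ge[OF T] by linarith
  next
    case False
    then show ?thesis using F_out[OF x] reaction[OF x] by auto
  qed
  have F_int: "set_integrable (hausdorff d) ?M F"
  proof (rule piecewise_continuous_integrable[OF d meas(2) _ _ F_in F_out])
    show "continuous_on T (\<phi> T)" if T: "T \<in> \<T>" for T
    proof -
      have sub: "T \<subseteq> ?M" using T by blast
      have prT: "pr x \<in> S" if "x \<in> T" for x using prS sub that by blast
      have "continuous_on T (\<lambda>x. (\<lambda>(x, z, \<xi>). b x z \<xi>) (pr x, u x, simplex_grad T u))"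
        by (rule continuous_on_compose2[OF b])
          (use prT in \<open>auto intro!: continuous_intros continuous_on_subset[OF cont(1) sub] continuous_on_subset[OF cont(2) sub]\<close>)
      then show ?thesis unfolding \<phi>_def by (auto intro!: continuous_intros)
    qed
    have "continuous_on ?M (\<lambda>x. (\<lambda>(x, z). q x z) (pr x, u x))"
      by (rule continuous_on_compose2[OF q]) (use prS in \<open>auto intro!: continuous_intros cont\<close>)
    moreover have "continuous_on ?M (\<lambda>x. (\<lambda>(x, z). q x z) (pr x, 0))"
      by (rule continuous_on_compose2[OF q]) (use prS in \<open>auto intro!: continuous_intros cont\<close>)
    ultimately show "continuous_on ?M \<psi>" unfolding \<psi>_def by (auto intro!: continuous_intros cont)
  qed
  have F_le: "(LINT x:?M|hausdorff d. F x) \<le> 0"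
  proof -
    \<comment> \<open>The sign alone gives the inequality; if \<open>?R\<close> fails to be integrable, its integral is 0.\<close>
    let ?R = "\<lambda>x. indicator ?M x *\<^sub>R ((f (pr x) - q (pr x) 0) * v x)"
    have "AE x in hausdorff d. 0 \<le> - ?R x"
      using sign
    proof eventually_elim
      case (elim x)
      then show ?case using v_nonneg[of x] by (auto simp: pr_def indicator_def mult_nonpos_nonneg)
    qed
    then have "0 \<le> (LINT x|hausdorff d. - ?R x)" by (rule integral_nonneg_AE)
    then have "(LINT x|hausdorff d. ?R x) \<le> 0" by simp
    then show ?thesis using weak[OF v0] by (simp add: F_def set_lebesgue_integral_def)
  qed
  have grad0: "simplex_grad T v = 0" if T: "T \<in> \<T>" for T
  proof -
    have "\<mu> * (norm (simplex_grad T v))\<^sup>2 \<le> 0"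
      by (rule nonneg_integrand_elem_bound[OF d meas(1) F_int F_nonneg F_le T F_ge[OF T]])
    then show ?thesis using b_pos(1) by (simp add: mult_le_0_iff)
  qed
  have v_zero: "v x = 0" if x: "x \<in> ?M" for x
  proof (rule conn[OF cont(3) _ _ x])
    have "finite (v ` T)" if T: "T \<in> \<T>" for T
    proof -
      obtain y where y: "y \<in> T" using nonempty_elem[OF T] by blast
      have "v z = v y" if "z \<in> T" for z
        unfolding v_def by (rule grad_zero_imp_constant[OF T grad0[OF T, unfolded v_def] that y])
      then have "v ` T \<subseteq> {v y}" by blast
      then show ?thesis by (rule finite_subset) simp
    qed
    then show "finite (v ` ?M)" using finite_mesh by (simp add: image_Union)
    fix y assume y: "y \<in> mesh_boundary \<T>"
    then have yM: "y \<in> ?M" using mesh_boundary_subset by blast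
    have "v y \<le> nodal_fun (\<lambda>_. 0) y"
      unfolding v_def by (rule nodal_fun_mono_boundary[OF y]) (simp add: vc0)
    then show "v y = 0" using v_nonneg[OF yM] nodal_fun_const[OF yM, of 0] by simp
  qed
  have c_le: "c B \<le> k" if B: "B \<in> mesh_vertices \<T>" for B
  proof -
    have "B \<in> ?M" using B by (auto simp: mesh_vertices_def extreme_point_of_def)
    then have "vc B = 0" using v_zero[of B] nodal_fun_node[OF B, of vc] by (simp add: v_def)
    then show ?thesis by (simp add: vc_def)
  qed
  show "u x \<le> k"
    using nodal_fun_mono[OF x, of c "\<lambda>_. k"] c_le nodal_fun_const[OF x, of k] by (simp add: c)
qed

end

text \<open>A continuous function with finitely many values is constant on connected sets, and the component of
  \<open>P x\<close> in \<open>S\<close> contains the image of a point of \<open>D\<close>.\<close>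

lemma finite_range_zero_by_components:
  fixes P :: "'a::euclidean_space \<Rightarrow> 'b::euclidean_space" and w :: "'a \<Rightarrow> real"
  assumes P: "compact M" "continuous_on M P" "bij_betw P M S"
    and D: "D \<subseteq> M" and comp: "\<And>C. C \<in> components S \<Longrightarrow> C \<inter> P ` D \<noteq> {}"
    and w: "continuous_on M w" "finite (w ` M)" "\<And>x. x \<in> D \<Longrightarrow> w x = 0" and x: "x \<in> M"
  shows "w x = 0"
proof -
  have inj: "inj_on P M" and im: "P ` M = S" using P(3) by (auto simp: bij_betw_def)
  define G where "G = the_inv_into M P"
  have G: "G (P y) = y" if "y \<in> M" for y using the_inv_into_f_f[OF inj that] by (simp add: G_def)
  have Gc: "continuous_on S G"
    unfolding im[symmetric] by (rule continuous_on_inv[OF P(2,1)]) (simp add: G)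
  define C where "C = connected_component_set S (P x)"
  have PxS: "P x \<in> S" using x im by blast
  have CS: "C \<subseteq> S" unfolding C_def by (rule connected_component_subset)
  have "C \<in> components S" unfolding C_def using PxS by (rule componentsI)
  then obtain y where y: "y \<in> D" "P y \<in> C" using comp by blast
  have "(\<lambda>z. w (G z)) constant_on C"
  proof (rule continuous_finite_range_constant)
    show "connected C" by (simp add: C_def)
    have "G z \<in> M" if z: "z \<in> C" for z
    proof -
      obtain y where "y \<in> M" "z = P y" using z CS im by blast
      then show ?thesis using G by simp
    qed
    then have "G ` C \<subseteq> M" by blast
    then show "continuous_on C (\<lambda>z. w (G z))"
      by (intro continuous_on_compose2[OF w(1)] continuous_on_subset[OF Gc CS])
    have "(\<lambda>z. w (G z)) ` C \<subseteq> w ` M" using \<open>G ` C \<subseteq> M\<close> by blast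
    then show "finite ((\<lambda>z. w (G z)) ` C)" using w(2) by (rule finite_subset)
  qed
  moreover have "P x \<in> C" using PxS by (simp add: C_def connected_component_refl_eq)
  ultimately have "w (G (P x)) = w (G (P y))" using y(2) unfolding constant_on_def by metis
  then show ?thesis using G x y D w(3) by auto
qed

lemma max_on_eqI:
  assumes "x \<in> A" "\<And>y. y \<in> A \<Longrightarrow> w y \<le> w x"
  shows "max_on A w = w x"
  unfolding max_on_def by (rule Greatest_equality) (use assms in auto)

theorem theorem3p3:
  fixes S :: "'a::euclidean_space set" and d :: nat
    and \<nu> :: "'a \<Rightarrow> 'a" and \<delta> :: "'a \<Rightarrow> real" and \<epsilon> :: real
    and b :: "'a \<Rightarrow> real \<Rightarrow> 'a \<Rightarrow> real" and q :: "'a \<Rightarrow> real \<Rightarrow> real"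
    and f g gstar :: "'a \<Rightarrow> real"
    and p p1 \<gamma> \<mu>0 \<mu>1 M0 M1 \<alpha> \<beta> c \<sigma>0 m1 m2 :: real
    and H :: "real set" and \<T> :: "real \<Rightarrow> 'a set set"
  assumes dim: "1 \<le> d" "DIM('a) = d + 1"
    and S: "regular_subdomain S" "unit_normal S \<nu>" "signed_distance S \<nu> \<epsilon> \<delta>"
    and A1: "2 \<le> p"
    and A2_b: "continuous_on (S \<times> UNIV \<times> UNIV) (\<lambda>(x, z, \<xi>). b x z \<xi>)"
    and A2_q: "continuous_on (closure S \<times> UNIV) (\<lambda>(x, z). q x z)"
    and A2_f: "Lp_on d (p / (p - 1)) S f"
    and A2_\<gamma>: "p > real d \<Longrightarrow> \<gamma> \<ge> p" "p \<le> real d \<Longrightarrow> \<gamma> > real d"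
    and A2_gstar: "sobolev1_on d \<gamma> S \<nu> gstar" "continuous_on S gstar"
    and A2_g: "\<And>x. x \<in> mfd_boundary S \<Longrightarrow> g x = gstar x"
    and A3_pos: "0 < \<mu>0" "0 < \<mu>1" "0 < M0" "0 < M1"
    and A3: "\<And>x z \<xi>. x \<in> S \<Longrightarrow>
               \<mu>0 + \<mu>1 * rpow (norm \<xi>) (p - 2) \<le> b x z \<xi> \<and>
               b x z \<xi> \<le> M0 + M1 * rpow (norm \<xi>) (p - 2)"
    and A4_p1: "2 \<le> p1" "real d > p \<Longrightarrow> p1 < 2 * real d / (real d - p)"
    and A4_pos: "0 \<le> \<alpha>" "0 \<le> \<beta>"
    and A4_nonpos: "\<And>x z. x \<in> S \<Longrightarrow> z \<le> 0 \<Longrightarrow> 0 \<le> q x 0 \<and> q x 0 = q x z"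
    and A4_nonneg: "\<And>x z. x \<in> S \<Longrightarrow> 0 \<le> z \<Longrightarrow>
               0 \<le> q x z - q x 0 \<and> q x z - q x 0 \<le> \<alpha> * z + \<beta> * z powr (p1 - 1)"
    and f_sign: "AE x in hausdorff d. x \<in> S \<longrightarrow> f x - q x 0 \<le> 0"
    and const_pos: "0 < c" "0 < \<sigma>0" "0 < m1" "0 < m2"
    and H: "H \<subseteq> {0<..}"
    and mesh: "\<And>h. h \<in> H \<Longrightarrow> admissible_mesh d S \<nu> \<epsilon> \<delta> c h (\<T> h)"
    and acute: "\<And>h B B' T x. h \<in> H \<Longrightarrow> B \<in> inner_vertices (\<T> h) \<Longrightarrow> B' \<in> mesh_vertices (\<T> h) \<Longrightarrow>
               B \<noteq> B' \<Longrightarrow> T \<in> \<T> h \<Longrightarrow>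
               x \<in> rel_interior T \<inter> hat_support (\<T> h) B \<inter> hat_support (\<T> h) B' \<Longrightarrow>
               mesh_grad (\<T> h) (hat (\<T> h) B) x \<bullet> mesh_grad (\<T> h) (hat (\<T> h) B') x \<le> - \<sigma>0 / h\<^sup>2"
    and meas: "\<And>h T. h \<in> H \<Longrightarrow> T \<in> \<T> h \<Longrightarrow>
               m1 * h ^ d \<le> measure (hausdorff d) T \<and> measure (hausdorff d) T \<le> m2 * h ^ d"
  shows "\<exists>h0>0. \<forall>h\<in>H. h < h0 \<longrightarrow>
           (\<forall>u. discrete_solution d S \<nu> \<delta> b q f g (\<T> h) u \<longrightarrow>
             (let ul = mesh_lift S \<nu> \<delta> (\<T> h) u;
                  gl = mesh_lift S \<nu> \<delta> (\<T> h) (boundary_interp (\<T> h) g)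
              in max_on (closure S) ul \<le> max 0 (max_on (mfd_boundary S) gl) \<and>
                 ((\<forall>x\<in>mfd_boundary S. g x \<ge> 0) \<longrightarrow>
                    max_on (closure S) ul = max_on (mfd_boundary S) gl) \<and>
                 ((\<forall>x\<in>mfd_boundary S. g x \<le> 0) \<longrightarrow> max_on (closure S) ul \<le> 0)))"
proof -
  have closed: "closed S" and "bounded S" and hs: "smooth_hypersurface S"
    and comps: "\<And>C. C \<in> components S \<Longrightarrow> C \<inter> mfd_boundary S \<noteq> {}"
    using S(1) unfolding regular_subdomain_def by blast+
  have comp: "compact S" using closed \<open>bounded S\<close> by (simp add: compact_eq_bounded_closed)
  have cl: "closure S = S" using closed by simp
  obtain h0 K where h0: "0 < h0" and K: "0 < K"
    and expanding: "\<And>h \<T> T x y. 0 < h \<Longrightarrow> h < h0 \<Longrightarrow> admissible_mesh d S \<nu> \<epsilon> \<delta> c h \<T> \<Longrightarrow> T \<in> \<T> \<Longrightarrow>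
        x \<in> T \<Longrightarrow> y \<in> T \<Longrightarrow> dist x y \<le> K * dist (nproj S \<nu> \<delta> x) (nproj S \<nu> \<delta> y)"
    by (rule nproj_expanding_on_fine_mesh[OF dim(2) comp hs S(2,3) const_pos(1)]) (rule that)
  have b_ge: "\<mu>0 \<le> b x z \<xi>" if "x \<in> S" for x z \<xi>
  proof -
    have "0 \<le> \<mu>1 * rpow (norm \<xi>) (p - 2)" using A3_pos by (simp add: rpow_def)
    then show ?thesis using A3[OF that, where z=z and \<xi>=\<xi>] by linarith
  qed
  have q_ge: "q x 0 \<le> q x z" if "x \<in> S" for x z
  proof (cases "z \<le> 0")
    case True
    then show ?thesis using A4_nonpos[OF that True] by linarith
  next
    case False
    then have "0 \<le> z" by simp
    then show ?thesis using A4_nonneg[OF that, of z] by linarith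
  qed
  show ?thesis
  proof (intro exI[of _ h0] conjI h0 ballI impI allI)
    fix h u assume hH: "h \<in> H" and hh: "h < h0" and sol: "discrete_solution d S \<nu> \<delta> b q f g (\<T> h) u"
    have h: "0 < h" using H hH by auto
    define M where "M = \<T> h"
    define pr where "pr = nproj S \<nu> \<delta>"
    have adm: "admissible_mesh d S \<nu> \<epsilon> \<delta> c h M" using mesh[OF hH] by (simp add: M_def)
    have tri: "triangulation M" "\<And>T. T \<in> M \<Longrightarrow> int d simplex T"
      and bv: "boundary_vertices M \<noteq> {}" "boundary_vertices M \<subseteq> mfd_boundary S"
      and tub: "\<Union>M \<subseteq> tube S \<nu> \<epsilon>" and bij: "bij_betw pr (\<Union>M) S"
      and bd: "pr ` mesh_boundary M = mfd_boundary S"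
      using adm unfolding admissible_mesh_def pr_def by blast+
    interpret mesh: simplicial_mesh M d
      by (unfold_locales) (use dim tri in auto)
    have cont: "continuous_on (\<Union>M) pr"
      using continuous_on_nproj[OF S(3) comp S(2)] tub unfolding pr_def by (rule continuous_on_subset)
    have meas': "0 < emeasure (hausdorff d) T" "emeasure (hausdorff d) T < \<infinity>" if T: "T \<in> M" for T
    proof -
      have "0 < m1 * h ^ d" using const_pos(3) h by simp
      then have "0 < measure (hausdorff d) T" using meas[OF hH, of T] T by (auto simp: M_def)
      then show "0 < emeasure (hausdorff d) T" "emeasure (hausdorff d) T < \<infinity>"
        by (auto simp: measure_def enn2real_positive_iff)
    qed
    have sign: "AE x in hausdorff d. x \<in> \<Union>M \<longrightarrow> f (pr x) - q (pr x) 0 \<le> 0"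
    proof (rule AE_hausdorff_expanding_pullback[OF dim(1) mesh.finite_mesh K _ _ f_sign])
      show "dist x y \<le> K * dist (pr x) (pr y)" if "T \<in> M" "x \<in> T" "y \<in> T" for T x y
        unfolding pr_def by (rule expanding[OF h hh adm that])
      show "pr ` \<Union>M \<subseteq> S" using bij by (simp add: bij_betw_def)
    qed
    have acute': "simplex_grad T (hat M B) \<bullet> simplex_grad T (hat M B') \<le> 0"
      if B: "B \<in> inner_vertices M" "B' \<in> mesh_vertices M" "B \<noteq> B'" "T \<in> M" "B \<in> T" "B' \<in> T" for B B' T
    proof -
      obtain x where x: "x \<in> rel_interior T"
        using rel_interior_eq_empty[OF mesh.convex_elem[OF B(4)]] mesh.nonempty_elem[OF B(4)] by blast
      have xM: "x \<in> \<Union>M" using x B(4) rel_interior_subset by blast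
      have Bm: "B \<in> mesh_vertices M" using B(1) by (simp add: inner_vertices_def)
      have supp: "x \<in> hat_support M V" if "V \<in> mesh_vertices M" "V \<in> T" for V
        unfolding hat_support_def
        using mesh.hat_pos_rel_interior[OF B(4) that x] xM by (intro subsetD[OF closure_subset]) auto
      have "x \<in> rel_interior T \<inter> hat_support M B \<inter> hat_support M B'"
        using x supp Bm B by blast
      from acute[OF hH, of B B' T x, folded M_def, OF B(1-4) this]
      have "simplex_grad T (hat M B) \<bullet> simplex_grad T (hat M B') \<le> - \<sigma>0 / h\<^sup>2"
        by (simp add: mesh.mesh_grad_rel_interior[OF B(4) x])
      also have "\<dots> \<le> 0" using const_pos(2) by simp
      finally show ?thesis .
    qed
    have zero: "w x = 0" if "continuous_on (\<Union>M) w" "finite (w ` \<Union>M)"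
        "\<And>x. x \<in> mesh_boundary M \<Longrightarrow> w x = 0" "x \<in> \<Union>M" for w :: "'a \<Rightarrow> real" and x
      by (rule finite_range_zero_by_components[OF mesh.compact_mesh cont bij mesh.mesh_boundary_subset])
        (use comps bd that in auto)
    \<comment> \<open>The common value of the two maxima, attained at the vertex \<open>B0\<close>.\<close>
    define k where "k = Max (g ` boundary_vertices M)"
    have fin: "finite (boundary_vertices M)"
      using mesh.finite_mesh_vertices by (simp add: boundary_vertices_def)
    have g_le: "g B \<le> k" if "B \<in> boundary_vertices M" for B using fin that by (simp add: k_def)
    have "k \<in> g ` boundary_vertices M" unfolding k_def using fin bv(1) by (intro Max_in) auto
    then obtain B0 where B0: "B0 \<in> boundary_vertices M" "g B0 = k" by blast
    have prS: "nproj S \<nu> \<delta> ` \<Union>M \<subseteq> S" using bij by (simp add: bij_betw_def pr_def)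
    have q': "continuous_on (S \<times> UNIV) (\<lambda>(x, z). q x z)" using A2_q cl by simp
    have u_le: "u x \<le> k" if "x \<in> \<Union>M" for x
      by (rule mesh.discrete_solution_le_boundary_values[where S=S and \<nu>=\<nu> and \<delta>=\<delta> and b=b and q=q
            and \<mu>=\<mu>0 and f=f and g=g and u=u and k=k])
        (fact dim(1) meas' prS A2_b q' A3_pos(1) b_ge q_ge cont[unfolded pr_def] sign[unfolded pr_def]
          acute' zero sol[folded M_def] g_le that)+
    have u_B0: "u B0 = k"
      using mesh.discrete_solution_boundary_value[OF sol[folded M_def] B0(1)] B0(2) by simp
    let ?ul = "mesh_lift S \<nu> \<delta> M u" and ?gl = "mesh_lift S \<nu> \<delta> M (boundary_interp M g)"
    have inj: "inj_on pr (\<Union>M)" and im: "pr ` \<Union>M = S" using bij by (auto simp: bij_betw_def)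
    have lift: "mesh_lift S \<nu> \<delta> M \<eta> (pr x) = \<eta> x" if "x \<in> \<Union>M" for \<eta> x
      using the_inv_into_f_f[OF inj that] by (simp add: mesh_lift_def pr_def)
    have B0b: "B0 \<in> mesh_boundary M" "B0 \<in> mesh_vertices M" using B0(1) by (auto simp: boundary_vertices_def)
    then have B0M: "B0 \<in> \<Union>M" using mesh.mesh_boundary_subset by blast
    have "max_on (closure S) ?ul = ?ul (pr B0)"
    proof (rule max_on_eqI)
      show "pr B0 \<in> closure S" using B0M im cl by auto
      fix y assume "y \<in> closure S"
      then obtain x where x: "x \<in> \<Union>M" "y = pr x" using im cl by auto
      then show "?ul y \<le> ?ul (pr B0)" using u_le[OF x(1)] by (simp only: x(2) lift[OF x(1)] lift[OF B0M] u_B0)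
    qed
    then have max_u: "max_on (closure S) ?ul = k" by (simp only: lift[OF B0M] u_B0)
    have gh_B0: "boundary_interp M g B0 = k"
      unfolding mesh.boundary_interp_eq using B0 mesh.nodal_fun_node[OF B0b(2)] by simp
    have gh_le: "boundary_interp M g x \<le> k" if x: "x \<in> mesh_boundary M" for x
    proof -
      have "boundary_interp M g x \<le> mesh.nodal_fun (\<lambda>_. k) x"
        unfolding mesh.boundary_interp_eq by (rule mesh.nodal_fun_mono_boundary[OF x]) (simp add: g_le)
      also have "\<dots> = k" by (rule mesh.nodal_fun_const) (use x mesh.mesh_boundary_subset in blast)
      finally show ?thesis .
    qed
    have "max_on (mfd_boundary S) ?gl = ?gl (pr B0)"
    proof (rule max_on_eqI)
      show "pr B0 \<in> mfd_boundary S" using B0b(1) bd by blast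
      fix y assume "y \<in> mfd_boundary S"
      then obtain x where x: "x \<in> mesh_boundary M" "y = pr x" using bd by blast
      then have xM: "x \<in> \<Union>M" using mesh.mesh_boundary_subset by blast
      show "?gl y \<le> ?gl (pr B0)" using gh_le[OF x(1)] by (simp only: x(2) lift[OF xM] lift[OF B0M] gh_B0)
    qed
    then have max_g: "max_on (mfd_boundary S) ?gl = k" by (simp only: lift[OF B0M] gh_B0)
    have k_le: "k \<le> 0" if "\<forall>x\<in>mfd_boundary S. g x \<le> 0" using that B0 bv(2) by blast
    show "let ul = mesh_lift S \<nu> \<delta> (\<T> h) u;
              gl = mesh_lift S \<nu> \<delta> (\<T> h) (boundary_interp (\<T> h) g)
          in max_on (closure S) ul \<le> max 0 (max_on (mfd_boundary S) gl) \<and>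
             ((\<forall>x\<in>mfd_boundary S. g x \<ge> 0) \<longrightarrow>
                max_on (closure S) ul = max_on (mfd_boundary S) gl) \<and>
             ((\<forall>x\<in>mfd_boundary S. g x \<le> 0) \<longrightarrow> max_on (closure S) ul \<le> 0)"
      unfolding Let_def M_def[symmetric] max_u max_g using k_le by simp
  qed
qed

end
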